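(* Let $\xi=e^{2\pi i/5}$, $\alpha=\frac{1+\sqrt5}2$, $\beta=\frac{1-\sqrt5}2$. Suppose that a relation of the form $\Omega(q,A(q),B(q))=0$ holds (identically in $q$), where $\Omega$ is a function of three variables. Then, for each $k=0,1,2,3,4$, $$\Omega\left(\xi^kq,\ \sqrt[5]{\frac{C^5(\xi^kq)-D^5(\xi^kq)}{\beta^5-\alpha^5}},\ \sqrt[5]{\frac{\beta^5C^5(\xi^kq)-\alpha^5D^5(\xi^kq)}{\beta^5-\alpha^5}}\right)=0,$$ where $$C(\xi^kq)=B(q^5)-\alpha\xi^kA(q^5),\qquad D(\xi^kq)=B(q^5)-\beta\xi^kA(q^5).$$
   Context: $q=e^{2\pi i\tau}$ with $\operatorname{Im}\tau>0$, $q^{r}=e^{2\pi ir\tau}$; "identically in $q$" means for all such $\tau$, and replacing $q$ by $\xi^kq$ means replacing $\tau$ by $\tau+k/5$. $(a;q)_\infty=\prod_{j\ge0}(1-aq^j)$, and fractional powers of $(q;q)_\infty$, $(q^5;q^5)_\infty$ are the branches whose power series have constant term $1$. The quintic theta functions are $$A(q)=q^{1/5}(q;q)_\infty^{-3/5}\sum_{n=-\infty}^{\infty}(-1)^nq^{(5n^2-3n)/2},\qquad B(q)=(q;q)_\infty^{-3/5}\sum_{n=-\infty}^{\infty}(-1)^nq^{(5n^2-n)/2},$$ $$C(q)=\frac{(q^5;q^5)_\infty^{-3/5}}{1+e^{3\pi i/5}}\sum_{n=-\infty}^{\infty}e^{3\pi in/5}q^{(n^2-n)/2},\qquad D(q)=\frac{(q^5;q^5)_\infty^{-3/5}}{1+e^{\pi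 i/5}}\sum_{n=-\infty}^{\infty}e^{\pi in/5}q^{(n^2-n)/2}.$$ The fifth roots are the holomorphic branches in $\tau$ with the following behaviour as $q\to0$: the first root is $e^{2\pi i(\tau+k/5)/5}(1+o(1))$ and the second is $1+o(1)$. *)

theory Defs
  imports "HOL-Analysis.Analysis"
begin

text \<open>
  The theta functions involve \<open>q^(1/5)\<close> and are therefore functions of \<open>\<tau>\<close> (with \<open>Im \<tau> > 0\<close>),
  not of \<open>q = exp (2 \<pi> i \<tau>)\<close>.  Replacing \<open>q\<close> by \<open>q ^ 5\<close> means replacing \<open>\<tau>\<close> by \<open>5 * \<tau>\<close>, and
  replacing \<open>q\<close> by \<open>\<xi> ^ k * q\<close> means replacing \<open>\<tau>\<close> by \<open>\<tau> + k / 5\<close>.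
\<close>

definition qpow :: "complex \<Rightarrow> real \<Rightarrow> complex" where
  "qpow \<tau> r = exp (2 * pi * \<i> * r * \<tau>)"

definition nome :: "complex \<Rightarrow> complex" where
  "nome \<tau> = exp (2 * pi * \<i> * \<tau>)"

definition qpoch_inf :: "complex \<Rightarrow> complex \<Rightarrow> complex" where
  "qpoch_inf a q = (\<Prod>j. 1 - a * q ^ j)"

text \<open>
  \<open>unit_branch f m d\<close> is the branch of \<open>f powr (m / d)\<close> that is holomorphic on the open unit disc
  (so given there by its power series) and has constant term 1.  It is meaningful for \<open>d > 0\<close> and
  \<open>f\<close> holomorphic and nonvanishing on the disc with \<open>f 0 = 1\<close>; any two such branches agree
  on the disc.
\<close>

definition unit_branch :: "(complex \<Rightarrow> complex) \<Rightarrow> int \<Rightarrow> nat \<Rightarrow> complex \<Rightarrow> complex" where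
  "unit_branch f m d q =
     (THE w. \<exists>g. g holomorphic_on ball 0 1 \<and> g 0 = 1 \<and>
                 (\<forall>z\<in>ball 0 1. g z ^ d = f z powi m) \<and> w = g q)"

definition quintic_A :: "complex \<Rightarrow> complex" where
  "quintic_A \<tau> =
     qpow \<tau> (1/5) * unit_branch (\<lambda>q. qpoch_inf q q) (-3) 5 (nome \<tau>) *
     (\<Sum>\<^sub>\<infinity>n::int. (-1) powi n * qpow \<tau> ((5 * n\<^sup>2 - 3 * n) / 2))"

definition quintic_B :: "complex \<Rightarrow> complex" where
  "quintic_B \<tau> =
     unit_branch (\<lambda>q. qpoch_inf q q) (-3) 5 (nome \<tau>) *
     (\<Sum>\<^sub>\<infinity>n::int. (-1) powi n * qpow \<tau> ((5 * n\<^sup>2 - n) / 2))"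

definition quintic_C :: "complex \<Rightarrow> complex" where
  "quintic_C \<tau> =
     unit_branch (\<lambda>q. qpoch_inf (q ^ 5) (q ^ 5)) (-3) 5 (nome \<tau>) / (1 + exp (3 * pi * \<i> / 5)) *
     (\<Sum>\<^sub>\<infinity>n::int. exp (3 * pi * \<i> * n / 5) * qpow \<tau> ((n\<^sup>2 - n) / 2))"

definition quintic_D :: "complex \<Rightarrow> complex" where
  "quintic_D \<tau> =
     unit_branch (\<lambda>q. qpoch_inf (q ^ 5) (q ^ 5)) (-3) 5 (nome \<tau>) / (1 + exp (pi * \<i> / 5)) *
     (\<Sum>\<^sub>\<infinity>n::int. exp (pi * \<i> * n / 5) * qpow \<tau> ((n\<^sup>2 - n) / 2))"

text \<open>
  \<open>R\<close> is a holomorphic fifth root of \<open>F\<close> on the upper half plane with \<open>R \<tau> = l \<tau> * (1 + o(1))\<close>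
  as \<open>q \<rightarrow> 0\<close>.
\<close>

definition fifth_root_branch ::
    "(complex \<Rightarrow> complex) \<Rightarrow> (complex \<Rightarrow> complex) \<Rightarrow> (complex \<Rightarrow> complex) \<Rightarrow> bool" where
  "fifth_root_branch F l R \<longleftrightarrow>
     R holomorphic_on {\<tau>. Im \<tau> > 0} \<and>
     (\<forall>\<tau>. Im \<tau> > 0 \<longrightarrow> R \<tau> ^ 5 = F \<tau>) \<and>
     ((\<lambda>\<tau>. R \<tau> / l \<tau>) \<longlongrightarrow> 1) (filtercomap nome (at 0))"

definition xi :: complex where
  "xi = exp (2 * pi * \<i> / 5)"

definition golden_alpha :: real where
  "golden_alpha = (1 + sqrt 5) / 2"

definition golden_beta :: real where
  "golden_beta = (1 - sqrt 5) / 2"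

end

theory Submission
  imports Defs "HOL-Complex_Analysis.Cauchy_Integral_Formula"
begin

text \<open>
  Splitting the sums for \<open>C\<close> and \<open>D\<close> by the residue of \<open>n\<close> modulo 5 and identifying the pieces by the
  Jacobi triple product gives \<open>C(q) = B(q^5) - \<alpha> A(q^5)\<close> and \<open>D(q) = B(q^5) - \<beta> A(q^5)\<close>; when \<open>q\<close>
  becomes \<open>\<xi>^k q\<close>, \<open>B(q^5)\<close> does not change and \<open>A(q^5)\<close> is multiplied by \<open>\<xi>^k\<close>.
  Multiplying over \<open>k\<close>, the linear factors combine to \<open>B(q^5)^5 - \<alpha>^5 A(q^5)^5\<close>, whereas the product
  expansion of \<open>C\<close> shows that \<open>\<Prod>k<5. C(\<xi>^k q) = C(q^5)^5\<close>.  Hence \<open>C^5 = B^5 - \<alpha>^5 A^5\<close> and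
  \<open>D^5 = B^5 - \<beta>^5 A^5\<close>, so the radicands are \<open>A^5\<close> and \<open>B^5\<close> at \<open>\<xi>^k q\<close>, and as \<open>A\<close> and \<open>B\<close> do not
  vanish, the asymptotics singles out \<open>A\<close> and \<open>B\<close> among the fifth roots.
\<close>

subsection \<open>Infinite products\<close>

lemma abs_convergent_prod_qpoch:
  fixes a q :: complex
  assumes "norm q < 1"
  shows "abs_convergent_prod (\<lambda>j. 1 - a * q ^ j)"
proof (rule summable_imp_abs_convergent_prod)
  have "summable (\<lambda>j. norm a * norm q ^ j)"
    using assms by (intro summable_mult summable_geometric) auto
  then show "summable (\<lambda>j. norm (1 - a * q ^ j - 1))"
    by (simp add: norm_mult norm_power)
qed

lemma qpoch_inf_LIMSEQ:
  assumes "norm q < 1"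
  shows "(\<lambda>n. \<Prod>j<n. 1 - a * q ^ j) \<longlonglongrightarrow> qpoch_inf a q"
  unfolding qpoch_inf_def
  by (intro has_prod_imp_tendsto' convergent_prod_has_prod abs_convergent_prod_imp_convergent_prod
        abs_convergent_prod_qpoch assms)

lemma qpoch_inf_nonzero:
  assumes "norm q < 1" "norm a < 1"
  shows "qpoch_inf a q \<noteq> 0"
  unfolding qpoch_inf_def
proof (rule prodinf_nonzero)
  show "convergent_prod (\<lambda>j. 1 - a * q ^ j)"
    using assms(1) by (intro abs_convergent_prod_imp_convergent_prod abs_convergent_prod_qpoch)
  fix j
  have "norm a * norm q ^ j \<le> norm a * 1"
    using assms by (intro mult_left_mono power_le_one) auto
  then have "norm (a * q ^ j) < 1"
    using assms by (simp add: norm_mult norm_power)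
  then show "1 - a * q ^ j \<noteq> 0"
    by auto
qed

lemma qpoch_inf_0 [simp]: "qpoch_inf 0 q = 1"
  by (simp add: qpoch_inf_def)

text \<open>The factors are grouped by the residue r of their index modulo m. Partial products of
  length \<open>n * m\<close> regroup exactly, and they form a subsequence of those converging to
  the left-hand side.\<close>

lemma qpoch_inf_split:
  assumes "norm q < 1" "m > 0"
  shows "qpoch_inf a q = (\<Prod>r<m. qpoch_inf (a * q ^ r) (q ^ m))"
proof (rule LIMSEQ_unique)
  have "norm (q ^ m) < 1"
    using assms by (simp add: norm_power power_less_one_iff)
  then have "(\<lambda>n. \<Prod>r<m. \<Prod>j<n. 1 - a * q ^ r * (q ^ m) ^ j)
               \<longlonglongrightarrow> (\<Prod>r<m. qpoch_inf (a * q ^ r) (q ^ m))"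
    by (intro tendsto_prod qpoch_inf_LIMSEQ)
  also have "(\<lambda>n. \<Prod>r<m. \<Prod>j<n. 1 - a * q ^ r * (q ^ m) ^ j) = (\<lambda>n. \<Prod>j<n * m. 1 - a * q ^ j)"
  proof
    fix n
    have "(\<Prod>j<n * m. 1 - a * q ^ j) = (\<Prod>j<n. \<Prod>i = j * m..<j * m + m. 1 - a * q ^ i)"
      by (rule prod.nat_group[symmetric])
    also have "\<dots> = (\<Prod>j<n. \<Prod>r<m. 1 - a * q ^ r * (q ^ m) ^ j)"
    proof (rule prod.cong)
      fix j
      show "(\<Prod>i = j * m..<j * m + m. 1 - a * q ^ i) = (\<Prod>r<m. 1 - a * q ^ r * (q ^ m) ^ j)"
      proof (rule prod.reindex_bij_witness[of _ "\<lambda>r. j * m + r" "\<lambda>i. i - j * m"])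
        fix i assume "i \<in> {j * m..<j * m + m}"
        then have "q ^ (i - j * m) * (q ^ m) ^ j = q ^ i"
          by (simp add: mult.commute flip: power_mult power_add)
        then show "1 - a * q ^ (i - j * m) * (q ^ m) ^ j = 1 - a * q ^ i"
          by (simp add: mult.assoc)
      qed auto
    qed auto
    also have "\<dots> = (\<Prod>r<m. \<Prod>j<n. 1 - a * q ^ r * (q ^ m) ^ j)"
      by (rule prod.swap)
    finally show "(\<Prod>r<m. \<Prod>j<n. 1 - a * q ^ r * (q ^ m) ^ j) = (\<Prod>j<n * m. 1 - a * q ^ j)" ..
  qed
  finally show "(\<lambda>n. \<Prod>j<n * m. 1 - a * q ^ j) \<longlonglongrightarrow> (\<Prod>r<m. qpoch_inf (a * q ^ r) (q ^ m))" .
  have "filterlim (\<lambda>n. n * m) sequentially sequentially"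
    using assms by (intro mult_nat_right_at_top) auto
  with qpoch_inf_LIMSEQ[OF assms(1)]
  show "(\<lambda>n. \<Prod>j<n * m. 1 - a * q ^ j) \<longlonglongrightarrow> qpoch_inf a q"
    by (rule filterlim_compose)
qed

lemma qpoch_inf_Suc:
  assumes "norm q < 1"
  shows "qpoch_inf a q = (1 - a) * qpoch_inf (a * q) q"
proof (rule LIMSEQ_unique)
  show "(\<lambda>n. \<Prod>j<Suc n. 1 - a * q ^ j) \<longlonglongrightarrow> qpoch_inf a q"
    using qpoch_inf_LIMSEQ[OF assms] by (rule LIMSEQ_Suc)
  have "(\<lambda>n. \<Prod>j<Suc n. 1 - a * q ^ j) = (\<lambda>n. (1 - a) * (\<Prod>j<n. 1 - a * q * q ^ j))"
    unfolding prod.lessThan_Suc_shift by (simp add: mult_ac)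
  then show "(\<lambda>n. \<Prod>j<Suc n. 1 - a * q ^ j) \<longlonglongrightarrow> (1 - a) * qpoch_inf (a * q) q"
    using tendsto_mult_left[OF qpoch_inf_LIMSEQ[OF assms, of "a * q"], of "1 - a"] by simp
qed

lemma holomorphic_qpoch_inf:
  assumes "m > 0"
  shows "(\<lambda>q. qpoch_inf (c * q ^ b) (q ^ m)) holomorphic_on ball 0 1"
proof (rule holomorphic_uniform_sequence[OF open_ball])
  show "(\<lambda>q. \<Prod>j<n. 1 - c * q ^ b * (q ^ m) ^ j) holomorphic_on ball 0 1" for n
    by (intro holomorphic_intros)
  fix z :: complex assume "z \<in> ball 0 1"
  then have z: "norm z < 1"
    by simp
  \<comment> \<open>\<open>d\<close> is half the distance from z to the unit circle, so
    \<open>cball z d\<close> lies in the closed disc of radius \<rho> < 1 about 0, where a geometric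
    series dominates the deviations of the factors from 1.\<close>
  define d where "d = (1 - norm z) / 2"
  define \<rho> where "\<rho> = (1 + norm z) / 2"
  have \<rho>: "0 < \<rho>" "\<rho> < 1"
    using z by (auto simp: \<rho>_def add_pos_nonneg)
  have le_\<rho>: "norm x \<le> \<rho>" if "x \<in> cball z d" for x
    using that norm_triangle_ineq2[of x z]
    by (auto simp: \<rho>_def d_def dist_norm norm_minus_commute field_simps)
  have d: "d > 0" "cball z d \<subseteq> ball 0 1"
    using z le_\<rho> \<rho> by (force simp: d_def)+
  have "uniformly_convergent_on (cball z d) (\<lambda>n x. \<Prod>j<n. 1 - c * x ^ b * (x ^ m) ^ j)"
  proof (rule uniformly_convergent_on_prod')
    show "uniformly_convergent_on (cball z d)
            (\<lambda>n x. \<Sum>j<n. norm (1 - c * x ^ b * (x ^ m) ^ j - 1))"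
    proof (rule Weierstrass_m_test')
      show "summable (\<lambda>j. norm c * (\<rho> ^ m) ^ j)"
        using \<rho> assms by (intro summable_mult summable_geometric) (auto simp: power_less_one_iff)
      fix j x assume x: "x \<in> cball z d"
      have "norm x ^ b \<le> 1"
        using le_\<rho>[OF x] \<rho> by (intro power_le_one) auto
      moreover have "(norm x ^ m) ^ j \<le> (\<rho> ^ m) ^ j"
        using le_\<rho>[OF x] by (intro power_mono) auto
      ultimately have "norm x ^ b * (norm x ^ m) ^ j \<le> 1 * (\<rho> ^ m) ^ j"
        by (intro mult_mono) auto
      then show "norm (norm (1 - c * x ^ b * (x ^ m) ^ j - 1)) \<le> norm c * (\<rho> ^ m) ^ j"
        by (simp add: norm_mult norm_power mult.assoc mult_left_mono)
    qed
  qed (auto intro!: continuous_intros)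
  then obtain g where g: "uniform_limit (cball z d) (\<lambda>n x. \<Prod>j<n. 1 - c * x ^ b * (x ^ m) ^ j) g
                            sequentially"
    by (auto simp: uniformly_convergent_on_def)
  have "g x = qpoch_inf (c * x ^ b) (x ^ m)" if "x \<in> cball z d" for x
  proof (rule LIMSEQ_unique)
    show "(\<lambda>n. \<Prod>j<n. 1 - c * x ^ b * (x ^ m) ^ j) \<longlonglongrightarrow> g x"
      using tendsto_uniform_limitI[OF g that] .
    have "norm (x ^ m) < 1"
      using le_\<rho>[OF that] \<rho> assms by (simp add: norm_power power_less_one_iff)
    then show "(\<lambda>n. \<Prod>j<n. 1 - c * x ^ b * (x ^ m) ^ j) \<longlonglongrightarrow> qpoch_inf (c * x ^ b) (x ^ m)"
      by (rule qpoch_inf_LIMSEQ)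
  qed
  then have "uniform_limit (cball z d) (\<lambda>n x. \<Prod>j<n. 1 - c * x ^ b * (x ^ m) ^ j)
               (\<lambda>x. qpoch_inf (c * x ^ b) (x ^ m)) sequentially"
    using g
    by (subst uniform_limit_cong'[where g = "\<lambda>n x. \<Prod>j<n. 1 - c * x ^ b * (x ^ m) ^ j" and i = g]) auto
  with d show "\<exists>d>0. cball z d \<subseteq> ball 0 1 \<and>
      uniform_limit (cball z d) (\<lambda>n x. \<Prod>j<n. 1 - c * x ^ b * (x ^ m) ^ j)
               (\<lambda>x. qpoch_inf (c * x ^ b) (x ^ m)) sequentially"
    by blast
qed

text \<open>The hypothesis says that \<omega> is a root of the fifth cyclotomic polynomial. In this
  form the factorisation of \<open>x ^ 5 - y ^ 5\<close> is a polynomial identity modulo that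
  relation.\<close>

lemma prod_5_root_unity:
  fixes \<omega> y :: "'a :: idom"
  assumes "1 + \<omega> + \<omega>^2 + \<omega>^3 + \<omega>^4 = 0"
  shows "(\<Prod>k<5. x - y * \<omega> ^ k) = x ^ 5 - y ^ 5"
proof -
  have "{..<5::nat} = {0, 1, 2, 3, 4}"
    by auto
  then have "(\<Prod>k<5. x - y * \<omega> ^ k)
      = (x - y) * (x - y * \<omega>) * (x - y * \<omega>^2) * (x - y * \<omega>^3) * (x - y * \<omega>^4)"
    by (simp add: mult.assoc)
  also have "\<dots> = x ^ 5 - y ^ 5"
    using assms by algebra
  finally show ?thesis .
qed

lemma prod_qpoch_inf_root_unity:
  fixes \<omega> :: complex
  assumes "norm q < 1" "1 + \<omega> + \<omega>^2 + \<omega>^3 + \<omega>^4 = 0"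
  shows "(\<Prod>k<5. qpoch_inf (a * \<omega> ^ k) q) = qpoch_inf (a ^ 5) (q ^ 5)"
proof (rule LIMSEQ_unique)
  show "(\<lambda>n. \<Prod>k<5. \<Prod>j<n. 1 - a * \<omega> ^ k * q ^ j) \<longlonglongrightarrow> (\<Prod>k<5. qpoch_inf (a * \<omega> ^ k) q)"
    using assms by (intro tendsto_prod qpoch_inf_LIMSEQ)
  have "(\<Prod>k<5. \<Prod>j<n. 1 - a * \<omega> ^ k * q ^ j) = (\<Prod>j<n. 1 - a ^ 5 * (q ^ 5) ^ j)" for n
  proof -
    have "(\<Prod>k<5. 1 - a * \<omega> ^ k * q ^ j) = 1 - a ^ 5 * (q ^ 5) ^ j" for j
      using prod_5_root_unity[OF assms(2), of 1 "a * q ^ j"]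
      by (simp add: mult_ac power_mult_distrib flip: power_mult)
    then show ?thesis
      by (subst prod.swap) simp
  qed
  moreover have "norm (q ^ 5) < 1"
    using assms by (simp add: norm_power power_less_one_iff)
  ultimately show "(\<lambda>n. \<Prod>k<5. \<Prod>j<n. 1 - a * \<omega> ^ k * q ^ j) \<longlonglongrightarrow> qpoch_inf (a ^ 5) (q ^ 5)"
    using qpoch_inf_LIMSEQ[of "q ^ 5" "a ^ 5"] by simp
qed

text \<open>Splitting each product modulo 5 gives the base \<open>q ^ 5\<close>, which does not
  depend on k. For an exponent prime to 5 the five rotated factors run over all fifth roots of unity
  and merge into one product with base \<open>q ^ 25\<close>; for an exponent divisible by 5 they
  coincide and give a fifth power. The identity avoids division because, for general c, the factor
  with base \<open>q ^ 25\<close> on the left may vanish.\<close>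

lemma prod_qpoch_inf_rotate:
  fixes \<omega> :: complex
  assumes q: "norm q < 1" and \<omega>: "1 + \<omega> + \<omega>^2 + \<omega>^3 + \<omega>^4 = 0"
  shows "(\<Prod>k<5. qpoch_inf (c * (\<omega> ^ k * q)) (\<omega> ^ k * q)) * qpoch_inf (c ^ 5 * q ^ 25) (q ^ 25)
           = qpoch_inf (c ^ 5 * q ^ 5) (q ^ 5) * qpoch_inf (c * q ^ 5) (q ^ 5) ^ 5"
proof -
  have \<omega>5: "\<omega> ^ 5 = 1"
    using \<omega> by algebra
  have [simp]: "norm \<omega> = 1"
    using \<omega>5 by (metis norm_one norm_power power_eq_1_iff zero_neq_numeral norm_ge_zero)
  have pow2: "1 + \<omega>^2 + (\<omega>^2)^2 + (\<omega>^2)^3 + (\<omega>^2)^4 = 0"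
    and pow3: "1 + \<omega>^3 + (\<omega>^3)^2 + (\<omega>^3)^3 + (\<omega>^3)^4 = 0"
    and pow4: "1 + \<omega>^4 + (\<omega>^4)^2 + (\<omega>^4)^3 + (\<omega>^4)^4 = 0"
    using \<omega> by algebra+
  have q5: "norm (q ^ 5) < 1"
    using q by (simp add: norm_power power_less_one_iff)
  have rot: "(\<omega> ^ k * q) ^ 5 = q ^ 5" for k
    using \<omega>5 by (simp add: power_mult_distrib) (metis mult.commute power_mult power_one)
  have "(\<Prod>k<5. qpoch_inf (c * (\<omega> ^ k * q)) (\<omega> ^ k * q))
          = (\<Prod>k<5. \<Prod>r<5. qpoch_inf (c * q ^ Suc r * (\<omega> ^ Suc r) ^ k) (q ^ 5))"
  proof (rule prod.cong)
    fix k
    have "norm (\<omega> ^ k * q) < 1"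
      using q by (simp add: norm_mult norm_power)
    then have "qpoch_inf (c * (\<omega> ^ k * q)) (\<omega> ^ k * q)
            = (\<Prod>r<5. qpoch_inf (c * (\<omega> ^ k * q) * (\<omega> ^ k * q) ^ r) (q ^ 5))"
      using qpoch_inf_split[of "\<omega> ^ k * q" 5 "c * (\<omega> ^ k * q)"] by (simp add: rot)
    also have "\<dots> = (\<Prod>r<5. qpoch_inf (c * q ^ Suc r * (\<omega> ^ Suc r) ^ k) (q ^ 5))"
    proof (rule prod.cong)
      fix r
      have "c * (\<omega> ^ k * q) * (\<omega> ^ k * q) ^ r = c * q ^ Suc r * (\<omega> ^ Suc r) ^ k"
        by (simp add: power_mult_distrib mult_ac flip: power_mult power_add)
      then show "qpoch_inf (c * (\<omega> ^ k * q) * (\<omega> ^ k * q) ^ r) (q ^ 5)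
                   = qpoch_inf (c * q ^ Suc r * (\<omega> ^ Suc r) ^ k) (q ^ 5)"
        by (rule arg_cong)
    qed auto
    finally show "qpoch_inf (c * (\<omega> ^ k * q)) (\<omega> ^ k * q)
       = (\<Prod>r<5. qpoch_inf (c * q ^ Suc r * (\<omega> ^ Suc r) ^ k) (q ^ 5))" .
  qed auto
  also have "\<dots> = (\<Prod>r<5. \<Prod>k<5. qpoch_inf (c * q ^ Suc r * (\<omega> ^ Suc r) ^ k) (q ^ 5))"
    by (rule prod.swap)
  also have "\<dots> = (\<Prod>r<4. qpoch_inf (c ^ 5 * q ^ 5 * (q ^ 5) ^ r) (q ^ 25)) * qpoch_inf (c * q ^ 5) (q ^ 5) ^ 5"
  proof -
    have "(\<Prod>k<5. qpoch_inf (c * q ^ Suc r * (\<omega> ^ Suc r) ^ k) (q ^ 5))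
            = qpoch_inf (c ^ 5 * q ^ 5 * (q ^ 5) ^ r) (q ^ 25)" if "r < 4" for r
    proof -
      have "r \<in> {0, 1, 2, 3}"
        using that by auto
      then have "1 + \<omega> ^ Suc r + (\<omega> ^ Suc r)^2 + (\<omega> ^ Suc r)^3 + (\<omega> ^ Suc r)^4 = 0"
        using pow2 pow3 pow4 \<omega> by (elim insertE emptyE) (simp_all add: eval_nat_numeral)
      from prod_qpoch_inf_root_unity[OF q5 this, of "c * q ^ Suc r"]
      show ?thesis
        by (simp add: power_mult_distrib mult_ac flip: power_mult)
    qed
    moreover have "(\<Prod>k<5. qpoch_inf (c * q ^ Suc 4 * (\<omega> ^ Suc 4) ^ k) (q ^ 5))
            = qpoch_inf (c * q ^ 5) (q ^ 5) ^ 5"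
      using \<omega>5 by simp
    ultimately show ?thesis
      \<comment> \<open>This instance rewrites 5 as \<open>Suc 4\<close>, so that the exceptional
        factor r = 4, where the exponent is divisible by 5, splits off.\<close>
      unfolding eval_nat_numeral(3)[of "num.Bit0 num.One"] prod.lessThan_Suc by simp
  qed
  \<comment> \<open>The extra factor is the missing one for r = 4. With it, the products with base
    \<open>q ^ 25\<close> are the splitting modulo 5 of a single product with base
    \<open>q ^ 5\<close>.\<close>
  also have "\<dots> * qpoch_inf (c ^ 5 * q ^ 25) (q ^ 25)
      = qpoch_inf (c ^ 5 * q ^ 5) (q ^ 5) * qpoch_inf (c * q ^ 5) (q ^ 5) ^ 5"
  proof -
    have "(\<Prod>r<Suc 4. qpoch_inf (c ^ 5 * q ^ 5 * (q ^ 5) ^ r) (q ^ 25)) = qpoch_inf (c ^ 5 * q ^ 5) (q ^ 5)"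
      using qpoch_inf_split[OF q5, of 5 "c ^ 5 * q ^ 5"] by (simp flip: power_mult)
    moreover have "c ^ 5 * q ^ 5 * (q ^ 5) ^ 4 = c ^ 5 * q ^ 25"
      by (simp add: mult.assoc flip: power_mult power_add)
    ultimately show ?thesis
      unfolding prod.lessThan_Suc by (simp only: mult_ac)
  qed
  finally show ?thesis .
qed

subsection \<open>The Jacobi triple product\<close>

text \<open>Dominated convergence for unordered sums: by the Weierstrass test the finite partial
  sums converge uniformly in n, which permits the exchange of the limit in n with the
  summation.\<close>

lemma has_sum_Tannery:
  fixes f :: "'a \<Rightarrow> nat \<Rightarrow> 'b :: banach"
  assumes has_sum: "\<And>n. ((\<lambda>x. f x n) has_sum S n) A"
    and lim: "\<And>x. x \<in> A \<Longrightarrow> f x \<longlonglongrightarrow> g x"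
    and bound: "\<And>x n. x \<in> A \<Longrightarrow> norm (f x n) \<le> M x"
    and M: "M summable_on A"
    and S: "S \<longlonglongrightarrow> s"
  shows "(g has_sum s) A"
proof -
  have "norm (g x) \<le> M x" if "x \<in> A" for x
    using tendsto_norm[OF lim[OF that]] bound[OF that] by (intro tendsto_upperbound) auto
  then have "(\<lambda>x. norm (g x)) summable_on A"
    by (intro summable_on_comparison_test[OF M]) auto
  then have g: "g summable_on A"
    by (rule abs_summable_summable)
  have "uniform_limit UNIV (\<lambda>X n. \<Sum>x\<in>X. f x n) S (finite_subsets_at_top A)"
    by (rule Weierstrass_m_test_general'[OF bound has_sum M])
  moreover have "\<forall>\<^sub>F X in finite_subsets_at_top A. (\<lambda>n. \<Sum>x\<in>X. f x n) \<longlonglongrightarrow> (\<Sum>x\<in>X. g x)"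
    by (intro eventually_finite_subsets_at_top_weakI tendsto_sum lim) auto
  moreover have "(sum g \<longlongrightarrow> infsum g A) (finite_subsets_at_top A)"
    using g by (simp flip: has_sum_def)
  ultimately have "S \<longlonglongrightarrow> infsum g A"
    by (intro swap_uniform_limit'[where f = "\<lambda>X n. \<Sum>x\<in>X. f x n" and F = "finite_subsets_at_top A"])
       auto
  with S have "infsum g A = s"
    by (rule LIMSEQ_unique[rotated])
  with g show ?thesis
    by (simp add: has_sum_iff)
qed

text \<open>The general term of the triple product series. The triangular exponent keeps all powers
  integral, since n(n-1) is even and the division is exact; all four quintic series are
  specialisations.\<close>

definition theta_term :: "complex \<Rightarrow> complex \<Rightarrow> int \<Rightarrow> complex" where
  "theta_term z q n = z powi n * q powi (n * (n - 1) div 2)"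

lemma triangular_add_1: "(n + 1) * (n + 1 - 1) div 2 = n * (n - 1) div 2 + (n :: int)"
proof -
  have "(n + 1) * (n + 1 - 1) = n * (n - 1) + n * 2"
    by (simp add: algebra_simps)
  then show ?thesis
    by simp
qed

lemma theta_term_add_1:
  assumes "q \<noteq> 0" "z \<noteq> 0"
  shows "theta_term z q (n + 1) = theta_term z q n * z * q powi n"
  using assms unfolding theta_term_def triangular_add_1 by (simp add: power_int_add)

lemma theta_term_minus:
  assumes "q \<noteq> 0" "z \<noteq> 0"
  shows "theta_term z q (- n) = theta_term (q / z) q n"
proof -
  have "- n * (- n - 1) = n * (n - 1) + n * 2"
    by (simp add: algebra_simps)
  then have "- n * (- n - 1) div 2 = n * (n - 1) div 2 + n"
    by simp
  then show ?thesis
    using assms unfolding theta_term_def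
    by (simp add: power_int_add power_int_divide_distrib power_int_minus field_simps)
qed

text \<open>On the nonnegative integers the quotients of successive terms are
  \<open>z * q ^ n\<close> and tend to 0, so the ratio test applies. The reflection of n to -n,
  which replaces z by \<open>q / z\<close>, covers the other half.\<close>

lemma theta_term_abs_summable:
  assumes "q \<noteq> 0" "z \<noteq> 0" "norm q < 1"
  shows "(\<lambda>n. norm (theta_term z q n)) summable_on UNIV"
proof -
  have nonneg: "(\<lambda>n. norm (theta_term z q n)) summable_on range int" if z: "z \<noteq> 0" for z
  proof -
    have "(\<lambda>n. norm z * norm q ^ n) \<longlonglongrightarrow> norm z * 0"
      using assms by (intro tendsto_mult tendsto_const LIMSEQ_power_zero) auto
    then have "\<forall>\<^sub>F n in sequentially. norm z * norm q ^ n < 1 / 2"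
      by (rule order_tendstoD) auto
    then obtain N where N: "norm z * norm q ^ n < 1 / 2" if "n \<ge> N" for n
      by (auto simp: eventually_sequentially)
    have "summable (\<lambda>n. norm (theta_term z q (int n)))"
    proof (rule summable_ratio_test)
      fix n assume "n \<ge> N"
      have "norm (theta_term z q (int (Suc n)))
              = norm (theta_term z q (int n)) * (norm z * norm q ^ n)"
        using theta_term_add_1[OF assms(1) z, of "int n"]
        by (simp add: norm_mult norm_power add.commute)
      also have "\<dots> \<le> norm (theta_term z q (int n)) * (1 / 2)"
        using N[OF \<open>n \<ge> N\<close>] by (intro mult_left_mono) auto
      finally show "norm (norm (theta_term z q (int (Suc n))))
                      \<le> 1 / 2 * norm (norm (theta_term z q (int n)))"
        by simp
    qed simp
    then have "(\<lambda>n. norm (theta_term z q (int n))) summable_on UNIV"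
      by (intro norm_summable_imp_summable_on) simp
    then show ?thesis
      by (subst summable_on_reindex) (auto simp: o_def)
  qed
  have "(\<lambda>n. norm (theta_term (q / z) q n)) summable_on range int"
    using assms by (intro nonneg) auto
  then have "(\<lambda>n. norm (theta_term z q (- n))) summable_on range int"
    by (simp add: theta_term_minus assms)
  then have "(\<lambda>n. norm (theta_term z q n)) summable_on uminus ` range int"
    by (subst summable_on_reindex) (auto simp: o_def)
  \<comment> \<open>Both halves contain 0, so it is removed from the second one to make the union
    disjoint.\<close>
  then have "(\<lambda>n. norm (theta_term z q n)) summable_on (uminus ` range int - range int)"
    by (rule summable_on_subset_banach) auto
  with nonneg[OF assms(2)]
  have "(\<lambda>n. norm (theta_term z q n)) summable_on (range int \<union> (uminus ` range int - range int))"
    by (intro summable_on_Un_disjoint) auto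
  also have "range int \<union> (uminus ` range int - range int) = UNIV"
  proof -
    have "n \<in> range int \<union> uminus ` range int" for n
      by (cases n rule: int_cases2) auto
    then show ?thesis
      by auto
  qed
  finally show ?thesis .
qed

section \<open>The finite form of the triple product\<close>

definition inv_qfac :: "complex \<Rightarrow> int \<Rightarrow> complex" where
  "inv_qfac q k = (if k < 0 then 0 else inverse (\<Prod>j<nat k. 1 - q * q ^ j))"

lemma qfac_nonzero:
  fixes q :: complex
  assumes "norm q < 1"
  shows "(\<Prod>j<n. 1 - q * q ^ j) \<noteq> 0"
proof -
  have "q * q ^ j \<noteq> 1" for j
  proof -
    have "norm (q ^ Suc j) < 1"
      using assms by (simp add: norm_power power_less_one_iff del: power_Suc)
    then show ?thesis
      by auto
  qed
  then show ?thesis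
    by auto
qed

text \<open>With the value 0 at negative integers, this recurrence holds without exception, so that the
  finite form of the triple product needs no boundary terms.\<close>

lemma inv_qfac_diff_1:
  assumes "norm q < 1"
  shows "inv_qfac q (k - 1) = (1 - q powi k) * inv_qfac q k"
proof (cases "k \<ge> 1")
  case True
  then obtain n where n: "k = int (Suc n)"
    by (intro that[of "nat (k - 1)"]) auto
  have "1 - q * q ^ n \<noteq> 0"
    using qfac_nonzero[OF assms, of "Suc n"] by simp
  then show ?thesis
    by (simp add: inv_qfac_def n power_int_def nat_add_distrib mult.left_commute)
next
  case False
  then show ?thesis
    by (cases "k = 0") (auto simp: inv_qfac_def)
qed

text \<open>The coefficients are the Gaussian binomials of 2N over N + n, written with inverse
  factorials so that they vanish for |n| > N. In the induction step the new factors contribute terms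
  in z and 1/z that shift n by one, and the recurrence of \<open>theta_term\<close> brings them back
  to the same power of z.\<close>

lemma Jacobi_triple_product_finite:
  assumes q: "q \<noteq> 0" "norm q < 1" and z: "z \<noteq> 0"
  shows "((\<lambda>n. (\<Prod>j<2*N. 1 - q * q ^ j) * inv_qfac q (int N - n) * inv_qfac q (int N + n)
              * theta_term z q n)
           has_sum ((\<Prod>j<N. 1 + z * q ^ j) * (\<Prod>j<N. 1 + q / z * q ^ j))) UNIV"
proof (induction N)
  case 0
  show ?case
    by (rule has_sum_finite_neutralI[where B = "{0}"]) (auto simp: inv_qfac_def theta_term_def)
next
  case (Suc N)
  define F where "F = (\<Prod>j<N. 1 + z * q ^ j) * (\<Prod>j<N. 1 + q / z * q ^ j)"
  define Q where "Q = (\<Prod>j<2*N. 1 - q * q ^ j)"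
  define f where "f n = Q * inv_qfac q (int N - n) * inv_qfac q (int N + n) * theta_term z q n" for n
  have f: "(f has_sum F) UNIV"
    using Suc.IH unfolding f_def F_def Q_def .
  have "((\<lambda>n. f (n - 1)) has_sum F) UNIV"
    using f by (subst has_sum_reindex_bij_witness[where i = "\<lambda>n. n + 1" and j = "\<lambda>n. n - 1"
                        and T = UNIV and h = f]) auto
  moreover have "((\<lambda>n. f (n + 1)) has_sum F) UNIV"
    using f by (subst has_sum_reindex_bij_witness[where i = "\<lambda>n. n - 1" and j = "\<lambda>n. n + 1"
                        and T = UNIV and h = f]) auto
  \<comment> \<open>The three coefficients come from expanding (1 + z q^N)(1 + q^(N+1)/z), the two
    factors that the step from N to N + 1 adds.\<close>
  ultimately have "((\<lambda>n. (1 + q ^ (2*N+1)) * f n + z * q ^ N * f (n - 1) + q ^ (N+1) / z * f (n + 1))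
      has_sum ((1 + q ^ (2*N+1)) * F + z * q ^ N * F + q ^ (N+1) / z * F)) UNIV"
    by (intro has_sum_add has_sum_cmult_right f)
  moreover have "(1 + q ^ (2*N+1)) * F + z * q ^ N * F + q ^ (N+1) / z * F
      = (\<Prod>j<Suc N. 1 + z * q ^ j) * (\<Prod>j<Suc N. 1 + q / z * q ^ j)"
  proof -
    have "(1 + q ^ (2*N+1)) * F + z * q ^ N * F + q ^ (N+1) / z * F
        = F * ((1 + z * q ^ N) * (1 + q / z * q ^ N))"
      using z by (simp add: field_simps mult_2_right power_add)
    then show ?thesis
      by (simp add: F_def)
  qed
  moreover have "(1 + q ^ (2*N+1)) * f n + z * q ^ N * f (n - 1) + q ^ (N+1) / z * f (n + 1)
     = (\<Prod>j<2 * Suc N. 1 - q * q ^ j) * inv_qfac q (int (Suc N) - n) * inv_qfac q (int (Suc N) + n)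
              * theta_term z q n" for n
  proof -
    \<comment> \<open>Every inverse factorial involved is expressed through \<open>R\<close> and
      \<open>S\<close>, those of highest index. What remains is a polynomial identity in
      \<open>q\<close>, \<open>X\<close> and \<open>Y\<close>.\<close>
    define X Y where "X = q powi (int N - n)" and "Y = q powi (int N + n)"
    define R S where "R = inv_qfac q (int N - n + 1)" and "S = inv_qfac q (int N + n + 1)"
    have XY: "X * Y = q ^ (2 * N)"
      using q unfolding X_def Y_def by (simp flip: power_int_add) (simp add: power_int_def nat_mult_distrib)
    have R0: "inv_qfac q (int N - n) = (1 - q * X) * R"
      using inv_qfac_diff_1[OF q(2), of "int N - n + 1"] q
      by (simp add: R_def X_def power_int_add mult.commute)
    have R1: "inv_qfac q (int N - n - 1) = (1 - X) * ((1 - q * X) * R)"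
      using inv_qfac_diff_1[OF q(2), of "int N - n"] by (simp add: X_def R0)
    have S0: "inv_qfac q (int N + n) = (1 - q * Y) * S"
      using inv_qfac_diff_1[OF q(2), of "int N + n + 1"] q
      by (simp add: S_def Y_def power_int_add mult.commute)
    have S1: "inv_qfac q (int N + n - 1) = (1 - Y) * ((1 - q * Y) * S)"
      using inv_qfac_diff_1[OF q(2), of "int N + n"] by (simp add: Y_def S0)
    have "theta_term z q n = theta_term z q (n - 1) * z * q powi (n - 1)"
      using theta_term_add_1[OF q(1) z, of "n - 1"] by simp
    then have "z * q ^ N * theta_term z q (n - 1) = theta_term z q n * q ^ N * inverse (q powi (n - 1))"
      using q z by simp
    also have "\<dots> = theta_term z q n * (q * X)"
      using q unfolding X_def by (simp add: power_int_diff field_simps)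
    finally have lower: "z * q ^ N * theta_term z q (n - 1) = theta_term z q n * (q * X)" .
    have upper: "q ^ (N+1) / z * theta_term z q (n + 1) = theta_term z q n * (q * Y)"
      using theta_term_add_1[OF q(1) z, of n] q z unfolding Y_def by (simp add: power_int_add)
    have "(1 + q ^ (2*N+1)) * f n + z * q ^ N * f (n - 1) + q ^ (N+1) / z * f (n + 1)
        = Q * ((1 + q * (X * Y)) * (inv_qfac q (int N - n) * inv_qfac q (int N + n) * theta_term z q n)
           + R * inv_qfac q (int N + n - 1) * (z * q ^ N * theta_term z q (n - 1))
           + inv_qfac q (int N - n - 1) * S * (q ^ (N+1) / z * theta_term z q (n + 1)))"
      by (simp add: f_def XY R_def S_def algebra_simps)
    also have "\<dots> = Q * (1 - q * (X * Y)) * (1 - q * q * (X * Y)) * R * S * theta_term z q n"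
      unfolding lower upper R0 R1 S0 S1 by algebra
    also have "Q * (1 - q * (X * Y)) * (1 - q * q * (X * Y)) = (\<Prod>j<2 * Suc N. 1 - q * q ^ j)"
      by (simp add: Q_def XY mult_ac)
    finally show ?thesis
      by (simp add: R_def S_def algebra_simps)
  qed
  ultimately show ?case
    by simp
qed

text \<open>Let N tend to infinity in the finite form. The Gaussian binomials tend to 1/E with E =
  (q;q)_\<infinity> and are bounded uniformly in N and n, so the summable theta terms dominate the
  series. Multiplication by E then clears the coefficient.\<close>

theorem Jacobi_triple_product:
  assumes q: "q \<noteq> 0" "norm q < 1" and z: "z \<noteq> 0"
  shows "(theta_term z q has_sum (qpoch_inf q q * qpoch_inf (- z) q * qpoch_inf (- q / z) q)) UNIV"
proof -
  define E where "E = qpoch_inf q q"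
  define Q where "Q n = (\<Prod>j<n. 1 - q * q ^ j)" for n
  have E: "E \<noteq> 0"
    unfolding E_def using q(2) by (intro qpoch_inf_nonzero)
  have Q_lim: "Q \<longlonglongrightarrow> E"
    unfolding Q_def E_def by (rule qpoch_inf_LIMSEQ[OF q(2)])
  have invQ_lim: "(\<lambda>n. inverse (Q n)) \<longlonglongrightarrow> inverse E"
    using Q_lim E by (rule tendsto_inverse)
  obtain K1 where K1: "K1 > 0" "\<And>n. norm (Q n) \<le> K1"
    using convergent_imp_Bseq[OF convergentI[OF Q_lim]] by (auto simp: Bseq_def)
  obtain K2 where K2: "K2 > 0" "\<And>n. norm (inverse (Q n)) \<le> K2"
    using convergent_imp_Bseq[OF convergentI[OF invQ_lim]] by (auto simp: Bseq_def)
  have inv_qfac_le: "norm (inv_qfac q k) \<le> K2" for k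
    using K2 by (auto simp: inv_qfac_def Q_def)
  \<comment> \<open>From some N on, \<open>int N + k\<close> is nonnegative and the value is the
    inverse of a genuine partial product.\<close>
  have inv_qfac_lim: "(\<lambda>N. inv_qfac q (int N + k)) \<longlonglongrightarrow> inverse E" for k
  proof (rule Lim_transform_eventually)
    have "filterlim (\<lambda>N. nat (int N + k)) sequentially sequentially"
      unfolding filterlim_at_top
    proof
      fix Z
      show "\<forall>\<^sub>F N in sequentially. Z \<le> nat (int N + k)"
        using eventually_ge_at_top[of "nat (int Z + \<bar>k\<bar>)"] by eventually_elim linarith
    qed
    then show "(\<lambda>N. inverse (Q (nat (int N + k)))) \<longlonglongrightarrow> inverse E"
      by (rule filterlim_compose[OF invQ_lim])
    show "\<forall>\<^sub>F N in sequentially. inverse (Q (nat (int N + k))) = inv_qfac q (int N + k)"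
      using eventually_ge_at_top[of "nat \<bar>k\<bar>"]
      by eventually_elim (auto simp: inv_qfac_def Q_def)
  qed
  have "((\<lambda>n. E * inverse E * inverse E * theta_term z q n)
          has_sum (qpoch_inf (- z) q * qpoch_inf (- (q / z)) q)) UNIV"
  proof (rule has_sum_Tannery[OF Jacobi_triple_product_finite[OF q z]])
    fix n
    have "strict_mono (\<lambda>N::nat. 2 * N)"
      by (auto simp: strict_mono_def)
    then have "(\<lambda>N. Q (2 * N)) \<longlonglongrightarrow> E"
      using LIMSEQ_subseq_LIMSEQ[OF Q_lim] by (auto simp: o_def)
    then show "(\<lambda>N. (\<Prod>j<2*N. 1 - q * q ^ j) * inv_qfac q (int N - n) * inv_qfac q (int N + n)
              * theta_term z q n) \<longlonglongrightarrow> E * inverse E * inverse E * theta_term z q n"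
      using inv_qfac_lim[of n] inv_qfac_lim[of "- n"]
      by (intro tendsto_mult tendsto_const) (auto simp: Q_def)
  next
    fix n N
    have "norm (Q (2*N) * inv_qfac q (int N - n) * inv_qfac q (int N + n) * theta_term z q n)
            \<le> K1 * K2 * K2 * norm (theta_term z q n)"
      unfolding norm_mult using K1 K2(1) inv_qfac_le by (intro mult_mono) (auto intro: less_imp_le)
    then show "norm ((\<Prod>j<2*N. 1 - q * q ^ j) * inv_qfac q (int N - n) * inv_qfac q (int N + n)
              * theta_term z q n) \<le> K1 * K2 * K2 * norm (theta_term z q n)"
      by (simp only: Q_def)
  next
    show "(\<lambda>n. K1 * K2 * K2 * norm (theta_term z q n)) summable_on UNIV"
      using q z by (intro summable_on_cmult_right theta_term_abs_summable)
  next
    show "(\<lambda>N. (\<Prod>j<N. 1 + z * q ^ j) * (\<Prod>j<N. 1 + q / z * q ^ j))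
            \<longlonglongrightarrow> qpoch_inf (- z) q * qpoch_inf (- (q / z)) q"
      using tendsto_mult[OF qpoch_inf_LIMSEQ[OF q(2), of "- z"] qpoch_inf_LIMSEQ[OF q(2), of "- (q / z)"]]
      by simp
  qed
  from has_sum_cmult_right[OF this, of E]
  have "((\<lambda>n. E * (E * inverse E * inverse E * theta_term z q n))
          has_sum (E * (qpoch_inf (- z) q * qpoch_inf (- (q / z)) q))) UNIV" .
  also have "(\<lambda>n. E * (E * inverse E * inverse E * theta_term z q n)) = theta_term z q"
    using E by (simp add: fun_eq_iff)
  finally show ?thesis
    by (simp add: E_def mult.assoc)
qed

subsection \<open>The quintic dissection\<close>

definition theta_prod :: "complex \<Rightarrow> complex \<Rightarrow> complex" where
  "theta_prod z q = qpoch_inf q q * qpoch_inf (- z) q * qpoch_inf (- q / z) q"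

lemma consecutive_product_even: "\<exists>t. n * (n - 1) = 2 * (t :: int)"
proof -
  have "even (n * (n - 1))"
    by simp
  then show ?thesis
    by (rule evenE) blast
qed

text \<open>For n = 5m + r the exponent n(n-1)/2 equals 25 m(m-1)/2 + (10 + 5r) m + r(r-1)/2, and
  x^(5m) = (-1)^m. So each residue class is again a theta series, with base
  \<open>q ^ 25\<close>.\<close>

lemma theta_term_dissect:
  assumes q: "q \<noteq> 0" and x: "x ^ 5 = - 1"
  shows "theta_term x q (5 * m + r)
           = x powi r * q powi (r * (r - 1) div 2) * theta_term (- (q powi (10 + 5 * r))) (q ^ 25) m"
proof -
  have [simp]: "x \<noteq> 0"
    using x by auto
  obtain s t where st: "m * (m - 1) = 2 * t" "r * (r - 1) = 2 * s"
    using consecutive_product_even by blast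
  have "(5 * m + r) * (5 * m + r - 1) = 25 * (m * (m - 1)) + r * (r - 1) + 2 * (m * (10 + 5 * r))"
    by (simp add: algebra_simps)
  then have e: "(5 * m + r) * (5 * m + r - 1) div 2 = 25 * t + s + (10 + 5 * r) * m"
    unfolding st by simp
  have "x powi (5 * m) = (- 1) powi m"
    using x by (simp add: power_int_mult)
  moreover have "(- (q powi (10 + 5 * r))) powi m = (- 1) powi m * q powi ((10 + 5 * r) * m)"
    using power_int_mult_distrib[of "- 1" "q powi (10 + 5 * r)" m] by (simp add: power_int_mult)
  moreover have "q powi (25 * t) = (q ^ 25) powi t"
    by (simp add: power_int_mult)
  moreover have "x powi (5 * m + r) = x powi (5 * m) * x powi r"
    by (simp add: power_int_add)
  moreover have "q powi (25 * t + s + (10 + 5 * r) * m)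
                   = q powi (25 * t) * q powi s * q powi ((10 + 5 * r) * m)"
    using q by (simp add: power_int_add)
  ultimately show ?thesis
    unfolding theta_term_def e by (simp only: st mult_ac) (simp add: mult_ac)
qed

lemma theta_prod_dissect:
  assumes q: "q \<noteq> 0" "norm q < 1" and x: "x ^ 5 = - 1"
  shows "theta_prod x q = (\<Sum>r\<in>{-2..2}. x powi r * q powi (r * (r - 1) div 2)
                                   * theta_prod (- (q powi (10 + 5 * r))) (q ^ 25))"
proof -
  let ?c = "\<lambda>r::int. x powi r * q powi (r * (r - 1) div 2) * theta_prod (- (q powi (10 + 5 * r))) (q ^ 25)"
  have "x \<noteq> 0"
    using x by auto
  then have "(theta_term x q has_sum theta_prod x q) UNIV"
    unfolding theta_prod_def by (intro Jacobi_triple_product q)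
  \<comment> \<open>The offset 2 in \<open>(n + 2) div 5\<close> centres the residues at 0, so that
    \<open>10 + 5 * r\<close> takes the values 0, 5, 10, 15, 20.\<close>
  also have "?this \<longleftrightarrow> ((\<lambda>(r, m). theta_term x q (5 * m + r)) has_sum theta_prod x q) ({-2..2} \<times> UNIV)"
    by (rule has_sum_reindex_bij_witness[of _ "\<lambda>(r, m). 5 * m + r"
          "\<lambda>n. (n - 5 * ((n + 2) div 5), (n + 2) div 5)"]) auto
  finally have total: "((\<lambda>(r, m). theta_term x q (5 * m + r)) has_sum theta_prod x q) ({-2..2} \<times> UNIV)" .
  have "norm (q ^ 25) < 1"
    using q by (simp add: norm_power power_less_one_iff)
  then have "((\<lambda>m. theta_term x q (5 * m + r)) has_sum ?c r) UNIV" for r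
    unfolding theta_term_dissect[OF q(1) x] theta_prod_def
    using q by (intro has_sum_cmult_right Jacobi_triple_product) auto
  then have "(?c has_sum theta_prod x q) {-2..2}"
    by (intro has_sum_SigmaD[OF total]) auto
  then show ?thesis
    by (simp add: has_sum_finite_iff)
qed

text \<open>\<open>theta_A\<close> and \<open>theta_B\<close> are the product forms of the series in
  A and B. Without the factor q^(1/5) they are functions of q, holomorphic on the disc.\<close>

definition theta_A :: "complex \<Rightarrow> complex" where
  "theta_A q = qpoch_inf (q ^ 5) (q ^ 5) * qpoch_inf q (q ^ 5) * qpoch_inf (q ^ 4) (q ^ 5)"

definition theta_B :: "complex \<Rightarrow> complex" where
  "theta_B q = qpoch_inf (q ^ 5) (q ^ 5) * qpoch_inf (q ^ 2) (q ^ 5) * qpoch_inf (q ^ 3) (q ^ 5)"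

text \<open>The residue -2 contributes 0 because its product contains the factor 1 - 1. The residues
  0 and 1 both yield \<open>theta_B\<close>, and -1 and 2 both yield \<open>theta_A\<close>, by the
  symmetry that exchanges z with q/z.\<close>

lemma theta_prod_quintic:
  assumes q: "q \<noteq> 0" "norm q < 1" and x: "x ^ 5 = - 1"
  shows "theta_prod x q = (1 + x) * theta_B (q ^ 5) + (x\<^sup>2 + 1 / x) * q * theta_A (q ^ 5)"
proof -
  have q25: "norm (q ^ 25) < 1"
    using q by (simp add: norm_power power_less_one_iff)
  have "qpoch_inf 1 (q ^ 25) = 0"
    using qpoch_inf_Suc[OF q25, of 1] by simp
  moreover have "q ^ 25 / q ^ m = q ^ (25 - m)" if "m \<le> 25" for m
    using q that by (simp add: power_diff)
  ultimately have "theta_prod (- (q powi 0)) (q ^ 25) = 0"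
    and "theta_prod (- (q powi 5)) (q ^ 25) = theta_A (q ^ 5)"
    and "theta_prod (- (q powi 10)) (q ^ 25) = theta_B (q ^ 5)"
    and "theta_prod (- (q powi 15)) (q ^ 25) = theta_B (q ^ 5)"
    and "theta_prod (- (q powi 20)) (q ^ 25) = theta_A (q ^ 5)"
    by (simp_all add: theta_prod_def theta_A_def theta_B_def flip: power_mult)
  moreover have "{-2..2::int} = {-2, -1, 0, 1, 2}"
    by auto
  ultimately show ?thesis
    unfolding theta_prod_dissect[OF assms] by (simp add: power_int_minus field_simps)
qed

lemma holomorphic_theta_A: "theta_A holomorphic_on ball 0 1"
  and holomorphic_theta_B: "theta_B holomorphic_on ball 0 1"
proof -
  have *: "(\<lambda>q. qpoch_inf (q ^ b) (q ^ 5)) holomorphic_on ball 0 1" for b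
    using holomorphic_qpoch_inf[of 5 1 b] by simp
  show "theta_A holomorphic_on ball 0 1"
    unfolding theta_A_def using *[of 1] *[of 4] *[of 5] by (intro holomorphic_on_mult) auto
  show "theta_B holomorphic_on ball 0 1"
    unfolding theta_B_def by (intro holomorphic_on_mult *)
qed

lemma theta_A_0 [simp]: "theta_A 0 = 1" and theta_B_0 [simp]: "theta_B 0 = 1"
  by (simp_all add: theta_A_def theta_B_def)

lemma theta_A_nonzero: "norm q < 1 \<Longrightarrow> theta_A q \<noteq> 0"
  and theta_B_nonzero: "norm q < 1 \<Longrightarrow> theta_B q \<noteq> 0"
  by (simp_all add: theta_A_def theta_B_def norm_power power_less_one_iff qpoch_inf_nonzero)

section \<open>The theta series as products in the nome\<close>

lemma qpow_of_int: "qpow \<tau> (of_int k) = nome \<tau> powi k"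
  by (simp add: qpow_def nome_def exp_power_int mult_ac)

lemma nome_nonzero [simp]: "nome \<tau> \<noteq> 0"
  by (simp add: nome_def)

lemma norm_nome_less_1_iff: "norm (nome \<tau>) < 1 \<longleftrightarrow> Im \<tau> > 0"
  by (simp add: nome_def zero_less_mult_iff)

text \<open>The exponent splits as e/2 = k n(n-1)/2 + l n, which is an integer. The pairs (k, l) in
  use are (5, 1) for A, (5, 2) for B, and (1, 0) for C and D.\<close>

lemma qpow_theta_term:
  assumes "e = int k * n\<^sup>2 - (int k - 2 * l) * n"
  shows "z powi n * qpow \<tau> (real_of_int e / 2) = theta_term (z * nome \<tau> powi l) (nome \<tau> ^ k) n"
proof -
  obtain t where t: "n * (n - 1) = 2 * t"
    using consecutive_product_even by blast
  have "e = int k * (n * (n - 1)) + 2 * (l * n)"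
    using assms by (simp add: power2_eq_square algebra_simps)
  then have "real_of_int e / 2 = of_int (l * n + int k * t)"
    unfolding t by simp
  then have "qpow \<tau> (real_of_int e / 2) = nome \<tau> powi (l * n) * (nome \<tau> ^ k) powi t"
    by (simp only: qpow_of_int) (simp add: power_int_add power_int_mult)
  with t show ?thesis
    by (simp add: theta_term_def power_int_mult_distrib power_int_mult mult_ac)
qed

lemma infsum_theta_term:
  assumes "q \<noteq> 0" "norm q < 1" "z \<noteq> 0"
  shows "infsum (theta_term z q) UNIV = theta_prod z q"
  using Jacobi_triple_product[OF assms] by (simp add: has_sum_iff theta_prod_def)

lemma infsum_A:
  assumes "Im \<tau> > 0"
  shows "(\<Sum>\<^sub>\<infinity>n::int. (-1) powi n * qpow \<tau> ((5 * n\<^sup>2 - 3 * n) / 2)) = theta_A (nome \<tau>)"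
proof -
  have "(\<Sum>\<^sub>\<infinity>n::int. (-1) powi n * qpow \<tau> ((5 * n\<^sup>2 - 3 * n) / 2))
      = infsum (theta_term (- nome \<tau>) (nome \<tau> ^ 5)) UNIV"
    by (intro infsum_cong, subst qpow_theta_term[where k = 5 and l = 1]) auto
  also have "\<dots> = theta_prod (- nome \<tau>) (nome \<tau> ^ 5)"
    using assms by (intro infsum_theta_term) (auto simp: norm_power power_less_one_iff norm_nome_less_1_iff)
  also have "\<dots> = theta_A (nome \<tau>)"
    by (simp add: theta_prod_def theta_A_def eval_nat_numeral)
  finally show ?thesis .
qed

lemma infsum_B:
  assumes "Im \<tau> > 0"
  shows "(\<Sum>\<^sub>\<infinity>n::int. (-1) powi n * qpow \<tau> ((5 * n\<^sup>2 - n) / 2)) = theta_B (nome \<tau>)"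
proof -
  have "(\<Sum>\<^sub>\<infinity>n::int. (-1) powi n * qpow \<tau> ((5 * n\<^sup>2 - n) / 2))
      = infsum (theta_term (- (nome \<tau> ^ 2)) (nome \<tau> ^ 5)) UNIV"
    by (intro infsum_cong, subst qpow_theta_term[where k = 5 and l = 2]) auto
  also have "\<dots> = theta_prod (- (nome \<tau> ^ 2)) (nome \<tau> ^ 5)"
    using assms by (intro infsum_theta_term) (auto simp: norm_power power_less_one_iff norm_nome_less_1_iff)
  also have "\<dots> = theta_B (nome \<tau>)"
    by (simp add: theta_prod_def theta_B_def eval_nat_numeral)
  finally show ?thesis .
qed

lemma infsum_CD:
  assumes "Im \<tau> > 0" "x \<noteq> 0"
  shows "(\<Sum>\<^sub>\<infinity>n::int. x powi n * qpow \<tau> ((n\<^sup>2 - n) / 2)) = theta_prod x (nome \<tau>)"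
proof -
  have "(\<Sum>\<^sub>\<infinity>n::int. x powi n * qpow \<tau> ((n\<^sup>2 - n) / 2)) = infsum (theta_term x (nome \<tau>)) UNIV"
    by (intro infsum_cong, subst qpow_theta_term[where k = 1 and l = 0]) auto
  then show ?thesis
    using assms by (simp add: infsum_theta_term norm_nome_less_1_iff)
qed

subsection \<open>The fifth powers of the quintic theta functions\<close>

text \<open>The quotient g/h is continuous with values among the finitely many d-th roots of unity,
  hence constant on a connected set, and it is 1 at a. This settles uniqueness of branches both on
  the disc and on the upper half plane.\<close>

lemma eq_if_power_eq_on_connected:
  fixes g h :: "complex \<Rightarrow> complex"
  assumes "connected S" "continuous_on S g" "continuous_on S h" "d > 0"
    and pow: "\<And>z. z \<in> S \<Longrightarrow> g z ^ d = h z ^ d" and nz: "\<And>z. z \<in> S \<Longrightarrow> h z \<noteq> 0"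
    and a: "a \<in> S" "g a = h a" and z: "z \<in> S"
  shows "g z = h z"
proof -
  have "(\<lambda>z. g z / h z) ` S \<subseteq> {w. w ^ d = 1}"
    using pow nz by (auto simp: power_divide)
  moreover have "finite {w :: complex. w ^ d = 1}"
    using assms(4) by (intro finite_roots_unity) auto
  ultimately have "finite ((\<lambda>z. g z / h z) ` S)"
    by (rule finite_subset)
  then have "(\<lambda>z. g z / h z) constant_on S"
    using assms(1-3) nz by (intro continuous_finite_range_constant continuous_intros) auto
  then have "g z / h z = g a / h a"
    using a(1) z by (auto simp: constant_on_def)
  then show ?thesis
    using nz[OF a(1)] nz[OF z] a(2) by simp
qed

lemma unit_branch_eqI:
  assumes "d > 0" and f: "\<And>z. z \<in> ball 0 1 \<Longrightarrow> f z \<noteq> 0"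
    and g: "g holomorphic_on ball 0 1" "g 0 = 1" "\<And>z. z \<in> ball 0 1 \<Longrightarrow> g z ^ d = f z powi m"
    and q: "norm q < 1"
  shows "unit_branch f m d q = g q"
  unfolding unit_branch_def
proof (rule the_equality)
  show "\<exists>h. h holomorphic_on ball 0 1 \<and> h 0 = 1 \<and> (\<forall>z\<in>ball 0 1. h z ^ d = f z powi m) \<and> g q = h q"
    using g by blast
  fix w
  assume "\<exists>h. h holomorphic_on ball 0 1 \<and> h 0 = 1 \<and> (\<forall>z\<in>ball 0 1. h z ^ d = f z powi m) \<and> w = h q"
  then obtain h where h: "h holomorphic_on ball 0 1" "h 0 = 1"
      "\<And>z. z \<in> ball 0 1 \<Longrightarrow> h z ^ d = f z powi m" and w: "w = h q"
    by blast
  have "h q = g q"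
  proof (rule eq_if_power_eq_on_connected[where g = h and h = g and S = "ball 0 1"
          and a = 0 and d = d])
    fix z :: complex assume z: "z \<in> ball 0 1"
    show "h z ^ d = g z ^ d"
      using g(3) h(3) z by simp
  next
    fix z :: complex assume z: "z \<in> ball 0 1"
    show "g z \<noteq> 0"
      using g(3)[OF z] f[OF z] \<open>d > 0\<close> by (metis power_int_eq_0_iff zero_power)
  qed (use g h q \<open>d > 0\<close> in \<open>auto intro: holomorphic_on_imp_continuous_on\<close>)
  with w show "w = g q"
    by simp
qed

lemma unit_branch_exists:
  assumes "d > 0" and f: "f holomorphic_on ball 0 1" "\<And>z. z \<in> ball 0 1 \<Longrightarrow> f z \<noteq> 0" "f 0 = 1"
  shows "\<exists>g. g holomorphic_on ball 0 1 \<and> g 0 = 1 \<and> (\<forall>z\<in>ball 0 1. g z ^ d = f z powi m)"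
proof -
  obtain L where L: "L holomorphic_on ball 0 1" "\<And>z. z \<in> ball 0 1 \<Longrightarrow> f z = exp (L z)"
    using contractible_imp_holomorphic_log[OF f(1) convex_imp_contractible[OF convex_ball] f(2)] by blast
  \<comment> \<open>\<open>L 0\<close> may be a nonzero multiple of 2 pi i; subtracting it gives
    \<open>g 0 = 1\<close> without changing the exponential of L.\<close>
  define g where "g z = exp (of_int m / of_nat d * (L z - L 0))" for z
  have "g z ^ d = f z powi m" if "z \<in> ball 0 1" for z
  proof -
    have "g z ^ d = exp (of_nat d * (of_int m / of_nat d * (L z - L 0)))"
      by (simp only: g_def exp_of_nat_mult)
    also have "of_nat d * (of_int m / of_nat d * (L z - L 0)) = of_int m * (L z - L 0)"
      using \<open>d > 0\<close> by simp
    also have "exp (of_int m * (L z - L 0)) = exp (L z - L 0) powi m"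
      by (simp only: exp_power_int)
    also have "exp (L z - L 0) = f z"
      using L(2)[OF that] L(2)[of 0] f(3) by (simp add: exp_diff)
    finally show ?thesis .
  qed
  moreover have "g holomorphic_on ball 0 1"
    unfolding g_def by (intro holomorphic_intros L)
  moreover have "g 0 = 1"
    by (simp add: g_def)
  ultimately show ?thesis
    by blast
qed

definition eta_root :: "complex \<Rightarrow> complex" where
  "eta_root = unit_branch (\<lambda>q. qpoch_inf q q) (-3) 5"

text \<open>The last claim follows from uniqueness: \<open>g (z ^ 5)\<close> is holomorphic, has
  value 1 at 0, and its fifth power is the required one.\<close>

lemma holomorphic_eta_root: "eta_root holomorphic_on ball 0 1"
  and eta_root_0: "eta_root 0 = 1"
  and eta_root_power: "norm q < 1 \<Longrightarrow> eta_root q ^ 5 * qpoch_inf q q ^ 3 = 1"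
  and unit_branch_eta_5: "norm q < 1 \<Longrightarrow>
        unit_branch (\<lambda>q. qpoch_inf (q ^ 5) (q ^ 5)) (-3) 5 q = eta_root (q ^ 5)"
proof -
  have hol: "(\<lambda>q. qpoch_inf q q) holomorphic_on ball 0 1"
    using holomorphic_qpoch_inf[of 1 1 1] by simp
  obtain g where g: "g holomorphic_on ball 0 1" "g 0 = 1"
      "\<And>z. z \<in> ball 0 1 \<Longrightarrow> g z ^ 5 = qpoch_inf z z powi (-3)"
    using unit_branch_exists[OF _ hol, of 5 "-3"] qpoch_inf_nonzero by fastforce
  have eq: "eta_root q = g q" if "norm q < 1" for q
    unfolding eta_root_def using that qpoch_inf_nonzero
    by (intro unit_branch_eqI g) auto
  show "eta_root holomorphic_on ball 0 1"
    using g(1) by (rule holomorphic_transform) (simp add: eq)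
  show "eta_root 0 = 1"
    by (simp add: eq g)
  show "eta_root q ^ 5 * qpoch_inf q q ^ 3 = 1" if "norm q < 1"
    using that qpoch_inf_nonzero[OF that that] by (simp add: eq g power_int_minus)
  have pow5: "norm (z ^ 5) < 1" if "norm z < 1" for z :: complex
    using that by (simp add: norm_power power_less_one_iff)
  have "(\<lambda>z. g (z ^ 5)) holomorphic_on ball 0 1"
    using pow5
    by (intro holomorphic_on_compose_gen[OF _ g(1), of "\<lambda>z. z ^ 5", unfolded o_def] holomorphic_intros) auto
  then show "unit_branch (\<lambda>q. qpoch_inf (q ^ 5) (q ^ 5)) (-3) 5 q = eta_root (q ^ 5)" if "norm q < 1"
    unfolding eq[OF pow5[OF that]] using g pow5 qpoch_inf_nonzero that
    by (intro unit_branch_eqI) auto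
qed

lemma eta_root_nonzero: "norm q < 1 \<Longrightarrow> eta_root q \<noteq> 0"
  using eta_root_power[of q] by auto

lemma quintic_A_eq:
  "Im \<tau> > 0 \<Longrightarrow> quintic_A \<tau> = qpow \<tau> (1/5) * (eta_root (nome \<tau>) * theta_A (nome \<tau>))"
  unfolding quintic_A_def by (subst infsum_A) (simp_all add: eta_root_def)

lemma quintic_B_eq:
  "Im \<tau> > 0 \<Longrightarrow> quintic_B \<tau> = eta_root (nome \<tau>) * theta_B (nome \<tau>)"
  unfolding quintic_B_def by (subst infsum_B) (simp_all add: eta_root_def)

text \<open>A common form of C and D, which differ only in the fifth root x of -1. The arguments
  below ask only for \<open>x ^ 5 = - 1\<close> and \<open>x \<noteq> - 1\<close>.\<close>

definition quintic_CD :: "complex \<Rightarrow> complex \<Rightarrow> complex" where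
  "quintic_CD x \<tau> = eta_root (nome \<tau> ^ 5) / (1 + x) * theta_prod x (nome \<tau>)"

lemma quintic_C_eq: "Im \<tau> > 0 \<Longrightarrow> quintic_C \<tau> = quintic_CD (exp (3 * pi * \<i> / 5)) \<tau>"
  and quintic_D_eq: "Im \<tau> > 0 \<Longrightarrow> quintic_D \<tau> = quintic_CD (exp (pi * \<i> / 5)) \<tau>"
proof -
  assume \<tau>: "Im \<tau> > 0"
  have *: "exp (x * of_int n / 5) = exp (x / 5) powi n" for x :: complex and n
    by (simp add: exp_power_int mult_ac)
  show "quintic_C \<tau> = quintic_CD (exp (3 * pi * \<i> / 5)) \<tau>"
    using \<tau> unfolding quintic_C_def quintic_CD_def *
    by (subst infsum_CD) (simp_all add: unit_branch_eta_5 norm_nome_less_1_iff)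
  show "quintic_D \<tau> = quintic_CD (exp (pi * \<i> / 5)) \<tau>"
    using \<tau> unfolding quintic_D_def quintic_CD_def *
    by (subst infsum_CD) (simp_all add: unit_branch_eta_5 norm_nome_less_1_iff)
qed

lemma nome_5 [simp]: "nome (5 * \<tau>) = nome \<tau> ^ 5"
  unfolding nome_def exp_of_nat_mult[symmetric] by (rule arg_cong[where f = exp]) simp

lemma qpow_fifth_5 [simp]: "qpow (5 * \<tau>) (1/5) = nome \<tau>"
  unfolding nome_def qpow_def by (rule arg_cong[where f = exp]) simp

text \<open>Since x^2 + 1/x = (1 + x)(x + 1/x - 1), the normalising denominator 1 + x cancels. The
  factor q in front of \<open>theta_A\<close> is the q^(1/5) of A taken at 5\<tau>.\<close>

lemma quintic_CD_dissect:
  assumes \<tau>: "Im \<tau> > 0" and x: "x ^ 5 = - 1" "x \<noteq> - 1"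
  shows "quintic_CD x \<tau> = quintic_B (5 * \<tau>) + (x + 1 / x - 1) * quintic_A (5 * \<tau>)"
proof -
  have nz: "1 + x \<noteq> 0" "x \<noteq> 0"
    using x by (auto simp: add_eq_0_iff)
  have "theta_prod x (nome \<tau>)
      = (1 + x) * theta_B (nome \<tau> ^ 5) + (x\<^sup>2 + 1 / x) * nome \<tau> * theta_A (nome \<tau> ^ 5)"
    using \<tau> x(1) by (intro theta_prod_quintic) (auto simp: norm_nome_less_1_iff)
  moreover have "x\<^sup>2 + 1 / x = (1 + x) * (x + 1 / x - 1)"
    using nz by (simp add: field_simps power2_eq_square)
  ultimately have "theta_prod x (nome \<tau>) = (1 + x) * (theta_B (nome \<tau> ^ 5)
                      + (x + 1 / x - 1) * nome \<tau> * theta_A (nome \<tau> ^ 5))"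
    by (simp only: distrib_left mult.assoc)
  then have "quintic_CD x \<tau> = eta_root (nome \<tau> ^ 5)
      * (theta_B (nome \<tau> ^ 5) + (x + 1 / x - 1) * nome \<tau> * theta_A (nome \<tau> ^ 5))"
    using nz(1) by (simp add: quintic_CD_def)
  also have "\<dots> = quintic_B (5 * \<tau>) + (x + 1 / x - 1) * quintic_A (5 * \<tau>)"
  proof -
    have "quintic_A (5 * \<tau>) = nome \<tau> * (eta_root (nome \<tau> ^ 5) * theta_A (nome \<tau> ^ 5))"
      "quintic_B (5 * \<tau>) = eta_root (nome \<tau> ^ 5) * theta_B (nome \<tau> ^ 5)"
      using \<tau> by (simp_all add: quintic_A_eq quintic_B_eq)
    then show ?thesis
      by (simp only: distrib_left mult_ac)
  qed
  finally show ?thesis .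
qed

section \<open>The root of unity \<xi> and translations of \<tau>\<close>

lemma xi_power_5: "xi ^ 5 = 1"
proof -
  have "xi ^ 5 = exp (of_nat 5 * (2 * pi * \<i> / 5))"
    by (simp only: xi_def exp_of_nat_mult)
  also have "of_nat 5 * (2 * pi * \<i> / 5) = 2 * pi * \<i>"
    by simp
  finally show ?thesis
    by simp
qed

lemma xi_cyclotomic: "1 + xi + xi^2 + xi^3 + xi^4 = 0"
proof -
  have "xi \<noteq> 1"
  proof
    assume "xi = 1"
    then obtain n :: int where "2 * pi / 5 = of_int (2 * n) * pi"
      by (auto simp: xi_def exp_eq_1)
    then have "real_of_int (5 * n) = real_of_int 1"
      by (simp add: field_simps)
    then have "5 * n = 1"
      by (simp only: of_int_eq_iff)
    then show False
      by presburger
  qed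
  moreover have "(xi - 1) * (1 + xi + xi^2 + xi^3 + xi^4) = 0"
    using xi_power_5 by algebra
  ultimately show ?thesis
    by simp
qed

lemma norm_xi [simp]: "norm xi = 1"
  by (simp add: xi_def)

lemma nome_add_fifth: "nome (\<tau> + of_nat k / 5) = xi ^ k * nome \<tau>"
  unfolding nome_def xi_def exp_of_nat_mult[symmetric] exp_add[symmetric]
  by (rule arg_cong[where f = exp]) (simp add: field_simps)

lemma
  assumes "Im \<tau> > 0"
  shows quintic_A_add_nat: "quintic_A (\<tau> + of_nat k) = xi ^ k * quintic_A \<tau>"
    and quintic_B_add_nat: "quintic_B (\<tau> + of_nat k) = quintic_B \<tau>"
proof -
  have nome: "nome (\<tau> + of_nat k) = nome \<tau>"
    using nome_add_fifth[of \<tau> "5 * k"] xi_power_5 by (simp add: power_mult)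
  have "qpow (\<tau> + of_nat k) (1/5) = xi ^ k * qpow \<tau> (1/5)"
    unfolding qpow_def xi_def exp_of_nat_mult[symmetric] exp_add[symmetric]
    by (rule arg_cong[where f = exp]) (simp add: field_simps)
  with assms nome show "quintic_A (\<tau> + of_nat k) = xi ^ k * quintic_A \<tau>"
    by (simp add: quintic_A_eq)
  from assms nome show "quintic_B (\<tau> + of_nat k) = quintic_B \<tau>"
    by (simp add: quintic_B_eq)
qed

text \<open>Cancelling 1 + x leaves the three products of \<open>P\<close>, to which the rotation
  formula applies with c = 1, -x and -1/x. Each has c^5 = 1, so the correction factors are cubes of
  (q^5;q^5)_\<infinity> and (q^25;q^25)_\<infinity>, exactly what the fifth powers of
  \<open>eta_root\<close> absorb.\<close>

lemma prod_quintic_CD: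
  assumes \<tau>: "Im \<tau> > 0" and x: "x ^ 5 = - 1" "x \<noteq> - 1"
  shows "(\<Prod>k<5. quintic_CD x (\<tau> + of_nat k / 5)) = quintic_CD x (5 * \<tau>) ^ 5"
proof -
  define q where "q = nome \<tau>"
  have nz: "1 + x \<noteq> 0" "x \<noteq> 0"
    using x by (auto simp: add_eq_0_iff)
  have q: "norm q < 1"
    using \<tau> by (simp add: q_def norm_nome_less_1_iff)
  have q_pow: "norm (q ^ n) < 1" if "n > 0" for n
    using q that by (simp add: norm_power power_less_one_iff)
  define P where "P q = qpoch_inf q q * qpoch_inf (- x * q) q * qpoch_inf (- (1 / x) * q) q" for q
  have CD: "quintic_CD x t = eta_root (nome t ^ 5) * P (nome t)" if "Im t > 0" for t
    using nz(1) that qpoch_inf_Suc[of "nome t" "- x"]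
    by (simp add: quintic_CD_def theta_prod_def P_def norm_nome_less_1_iff)
  have rot: "(xi ^ k * q) ^ 5 = q ^ 5" for k
    by (metis mult.commute mult_1 power_mult power_mult_distrib power_one xi_power_5)
  have *: "(\<Prod>k<5. P (xi ^ k * q)) * qpoch_inf (q ^ 25) (q ^ 25) ^ 3
                = qpoch_inf (q ^ 5) (q ^ 5) ^ 3 * P (q ^ 5) ^ 5"
  proof -
    have "(- x) ^ 5 = 1" "(- (1 / x)) ^ 5 = 1"
      using x(1) by (simp_all add: power_one_over)
    with prod_qpoch_inf_rotate[OF q xi_cyclotomic, of 1]
      prod_qpoch_inf_rotate[OF q xi_cyclotomic, of "- x"]
      prod_qpoch_inf_rotate[OF q xi_cyclotomic, of "- (1 / x)"]
    show ?thesis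
      unfolding P_def prod.distrib power_mult_distrib
      by (simp only: mult_1 power_one) algebra
  qed
  have "(\<Prod>k<5. quintic_CD x (\<tau> + of_nat k / 5)) = (\<Prod>k<5. eta_root (q ^ 5) * P (xi ^ k * q))"
    using \<tau> by (intro prod.cong) (auto simp: CD nome_add_fifth q_def[symmetric] rot)
  also have "\<dots> = eta_root (q ^ 5) ^ 5 * (\<Prod>k<5. P (xi ^ k * q))"
    by (simp add: prod.distrib)
  also have "(\<Prod>k<5. P (xi ^ k * q))
      = qpoch_inf (q ^ 5) (q ^ 5) ^ 3 * P (q ^ 5) ^ 5 * eta_root (q ^ 25) ^ 5"
  proof -
    have "eta_root (q ^ 25) ^ 5 * qpoch_inf (q ^ 25) (q ^ 25) ^ 3 = 1"
      by (intro eta_root_power q_pow) simp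
    with * show ?thesis
      by algebra
  qed
  also have "eta_root (q ^ 5) ^ 5 * \<dots> = (eta_root (q ^ 25) * P (q ^ 5)) ^ 5"
  proof -
    have "eta_root (q ^ 5) ^ 5 * qpoch_inf (q ^ 5) (q ^ 5) ^ 3 = 1"
      by (intro eta_root_power q_pow) simp
    then show ?thesis
      by algebra
  qed
  also have "\<dots> = quintic_CD x (5 * \<tau>) ^ 5"
    using \<tau> by (simp add: CD q_def flip: power_mult)
  finally show ?thesis .
qed

text \<open>The product formula is used at \<tau>/5. Five times \<tau>/5 + k/5 is \<tau> + k, so the
  dissection turns the factors into B + c \<xi>^k A, whose product is a difference of fifth
  powers.\<close>

lemma quintic_CD_power_5:
  assumes \<tau>: "Im \<tau> > 0" and x: "x ^ 5 = - 1" "x \<noteq> - 1"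
  shows "quintic_CD x \<tau> ^ 5 = quintic_B \<tau> ^ 5 + (x + 1 / x - 1) ^ 5 * quintic_A \<tau> ^ 5"
proof -
  define c where "c = x + 1 / x - 1"
  have "quintic_CD x \<tau> ^ 5 = (\<Prod>k<5. quintic_CD x (\<tau> / 5 + of_nat k / 5))"
    using prod_quintic_CD[of "\<tau> / 5" x] \<tau> x by simp
  also have "\<dots> = (\<Prod>k<5. quintic_B \<tau> - (- c * quintic_A \<tau>) * xi ^ k)"
  proof (rule prod.cong)
    fix k
    have "quintic_CD x (\<tau> / 5 + of_nat k / 5)
            = quintic_B (\<tau> + of_nat k) + c * quintic_A (\<tau> + of_nat k)"
      using quintic_CD_dissect[of "\<tau> / 5 + of_nat k / 5" x] \<tau> x by (simp add: distrib_left c_def)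
    then show "quintic_CD x (\<tau> / 5 + of_nat k / 5) = quintic_B \<tau> - (- c * quintic_A \<tau>) * xi ^ k"
      using \<tau> by (simp add: quintic_A_add_nat quintic_B_add_nat mult_ac)
  qed auto
  also have "\<dots> = quintic_B \<tau> ^ 5 + c ^ 5 * quintic_A \<tau> ^ 5"
    unfolding prod_5_root_unity[OF xi_cyclotomic] by (simp add: power_mult_distrib)
  finally show ?thesis
    unfolding c_def .
qed

subsection \<open>Fifth root branches\<close>

text \<open>Division of x^5 + 1 by x + 1 shows that w = x + 1/x = 2 cos \<theta> satisfies w^2 - w -
  1 = 0, so w is \<alpha> or \<beta> according to its sign. As \<alpha> + \<beta> = 1, subtracting 1
  gives minus the other root.\<close>

lemma cis_fifth_root_minus_1:
  assumes "cis \<theta> ^ 5 = - 1" "cis \<theta> \<noteq> - 1"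
  shows "(cos \<theta> > 0 \<longrightarrow> cis \<theta> + 1 / cis \<theta> - 1 = - of_real golden_beta) \<and>
         (cos \<theta> < 0 \<longrightarrow> cis \<theta> + 1 / cis \<theta> - 1 = - of_real golden_alpha)"
proof -
  define x where "x = cis \<theta>"
  define w where "w = 2 * cos \<theta>"
  have x: "x ^ 5 = - 1" "x \<noteq> - 1" "x \<noteq> 0"
    using assms by (auto simp: x_def)
  have w: "x + 1 / x = of_real w"
    unfolding x_def w_def by (simp add: complex_eq_iff cis_inverse divide_inverse)
  have "(x + 1) * (x^4 - x^3 + x^2 - x + 1) = 0"
    using x(1) by algebra
  then have "x^4 - x^3 + x^2 - x + 1 = 0"
    using x(2) by (auto simp: add_eq_0_iff2)
  moreover have "x\<^sup>2 * ((x + 1 / x)\<^sup>2 - (x + 1 / x) - 1) = x^4 - x^3 + x^2 - x + 1"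
    using x(3) by (simp add: field_simps eval_nat_numeral)
  ultimately have "(of_real w)\<^sup>2 - of_real w - (1 :: complex) = 0"
    using x(3) unfolding w by simp
  then have "complex_of_real (w\<^sup>2 - w - 1) = 0"
    by simp
  then have "w\<^sup>2 - w - 1 = 0"
    by (simp only: of_real_eq_0_iff)
  moreover have "(w - golden_alpha) * (w - golden_beta) = w\<^sup>2 - w - 1"
    by (simp add: golden_alpha_def golden_beta_def field_simps power2_eq_square)
  ultimately have "w = golden_alpha \<or> w = golden_beta"
    by simp
  moreover have "golden_alpha > 0" "golden_beta < 0" "golden_alpha + golden_beta = 1"
    by (simp_all add: golden_alpha_def golden_beta_def add_pos_pos field_simps)
  ultimately have "(cos \<theta> > 0 \<longrightarrow> w - 1 = - golden_beta) \<and> (cos \<theta> < 0 \<longrightarrow> w - 1 = - golden_alpha)"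
    by (auto simp: w_def)
  moreover have "cis \<theta> + 1 / cis \<theta> - 1 = of_real (w - 1)"
    using w by (simp add: x_def)
  ultimately show ?thesis
    by (metis of_real_minus)
qed

lemma quintic_C_root:
  defines "x \<equiv> exp (3 * pi * \<i> / 5)"
  shows "x ^ 5 = - 1" "x \<noteq> - 1" "x + 1 / x - 1 = - of_real golden_alpha"
proof -
  have x: "x = cis (3 * pi / 5)"
    by (simp add: x_def cis_conv_exp mult_ac)
  have "x ^ 5 = cis (3 * pi)"
    unfolding x Complex.DeMoivre by simp
  also have "\<dots> = - 1"
    using cis_mult[of "2 * pi" pi] by simp
  finally show x5: "x ^ 5 = - 1" .
  have "sin (3 * pi / 5) > 0"
    by (intro sin_gt_zero) auto
  then show x1: "x \<noteq> - 1"
    by (auto simp: x complex_eq_iff)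
  have "cos (pi - 3 * pi / 5) > 0"
    by (intro cos_gt_zero_pi) (auto simp: field_simps)
  then have "cos (3 * pi / 5) < 0"
    unfolding cos_diff by simp
  then show "x + 1 / x - 1 = - of_real golden_alpha"
    using x5 x1 cis_fifth_root_minus_1[of "3 * pi / 5"] by (simp add: x)
qed

lemma quintic_D_root:
  defines "x \<equiv> exp (pi * \<i> / 5)"
  shows "x ^ 5 = - 1" "x \<noteq> - 1" "x + 1 / x - 1 = - of_real golden_beta"
proof -
  have x: "x = cis (pi / 5)"
    by (simp add: x_def cis_conv_exp mult_ac)
  show x5: "x ^ 5 = - 1"
    unfolding x Complex.DeMoivre by simp
  have "sin (pi / 5) > 0"
    by (intro sin_gt_zero) auto
  then show x1: "x \<noteq> - 1"
    by (auto simp: x complex_eq_iff)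
  have "cos (pi / 5) > 0"
    by (intro cos_gt_zero_pi) (auto simp: field_simps)
  then show "x + 1 / x - 1 = - of_real golden_beta"
    using x5 x1 cis_fifth_root_minus_1[of "pi / 5"] by (simp add: x)
qed

lemma golden_power_5_neq: "complex_of_real golden_beta ^ 5 - of_real golden_alpha ^ 5 \<noteq> 0"
proof -
  have "golden_beta < 0" "golden_alpha > 0"
    by (simp_all add: golden_alpha_def golden_beta_def add_pos_pos field_simps)
  then have "golden_beta ^ 5 < 0" "golden_alpha ^ 5 > 0"
    by simp_all
  then have "golden_beta ^ 5 - golden_alpha ^ 5 \<noteq> 0"
    by linarith
  then show ?thesis
    by (metis of_real_diff of_real_eq_0_iff of_real_power)
qed

lemma holomorphic_nome: "nome holomorphic_on A"
  unfolding nome_def by (intro holomorphic_intros)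

text \<open>Every nonzero q is attained by \<open>nome\<close>, at a logarithm of q divided by 2 pi
  i. Properness of the filter is what yields an actual point from an eventual property.\<close>

lemma filtercomap_nome_neq_bot: "filtercomap nome (at 0) \<noteq> bot"
proof (rule filtercomap_neq_bot)
  fix P assume "eventually P (at (0 :: complex))"
  then obtain d :: real where d: "d > 0" "\<And>z. z \<noteq> 0 \<Longrightarrow> dist z 0 < d \<Longrightarrow> P z"
    by (auto simp: eventually_at)
  define z :: complex where "z = of_real (d / 2)"
  have z: "z \<noteq> 0" "dist z 0 < d"
    using d(1) by (auto simp: z_def norm_divide)
  then have "nome (Ln z / (2 * pi * \<i>)) = z"
    by (simp add: nome_def)
  with d(2)[OF z] show "\<exists>\<tau>. P (nome \<tau>)"
    by metis
qed

lemma eventually_nome_Im_pos: "\<forall>\<^sub>F \<tau> in filtercomap nome (at 0). Im \<tau> > 0"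
proof -
  have "\<forall>\<^sub>F q in at (0 :: complex). norm q < 1"
    using eventually_at_ball[of 1 "0 :: complex" UNIV] by simp
  then show ?thesis
    by (rule eventually_filtercomapI[THEN eventually_mono]) (simp add: norm_nome_less_1_iff)
qed

text \<open>The asymptotics is continuity of \<phi> at 0, where its value is 1. The rotation c,
  which is \<open>xi ^ k\<close> in the application, keeps \<open>c * nome \<tau>\<close> in the
  disc.\<close>

lemma fifth_root_branchI:
  assumes l: "l holomorphic_on {\<tau>. Im \<tau> > 0}" "\<And>\<tau>. l \<tau> \<noteq> 0"
    and \<phi>: "\<phi> holomorphic_on ball 0 1" "\<phi> 0 = 1" and c: "norm c = 1"
    and F: "\<And>\<tau>. Im \<tau> > 0 \<Longrightarrow> F \<tau> = (l \<tau> * \<phi> (c * nome \<tau>)) ^ 5"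
  shows "fifth_root_branch F l (\<lambda>\<tau>. l \<tau> * \<phi> (c * nome \<tau>))"
  unfolding fifth_root_branch_def
proof (intro conjI allI impI)
  have "(\<lambda>\<tau>. \<phi> (c * nome \<tau>)) holomorphic_on {\<tau>. Im \<tau> > 0}"
    using c by (intro holomorphic_on_compose_gen[OF _ \<phi>(1), unfolded o_def]
        holomorphic_intros holomorphic_nome) (auto simp: norm_mult norm_nome_less_1_iff)
  then show "(\<lambda>\<tau>. l \<tau> * \<phi> (c * nome \<tau>)) holomorphic_on {\<tau>. Im \<tau> > 0}"
    by (intro holomorphic_intros l)
  have "isCont \<phi> 0"
    using holomorphic_on_imp_continuous_on[OF \<phi>(1)] by (simp add: continuous_on_eq_continuous_at)
  then have "isCont \<phi> (c * 0)"
    by simp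
  moreover have "isCont (\<lambda>q. c * q) 0"
    by (intro continuous_intros)
  ultimately have "isCont (\<lambda>q. \<phi> (c * q)) 0"
    by (rule isCont_o2[rotated])
  then have "((\<lambda>q. \<phi> (c * q)) \<longlongrightarrow> 1) (at 0)"
    using \<phi>(2) by (simp add: isCont_def)
  then have "((\<lambda>\<tau>. \<phi> (c * nome \<tau>)) \<longlongrightarrow> 1) (filtercomap nome (at 0))"
    by (rule filterlim_compose[OF _ filterlim_filtercomap])
  then show "((\<lambda>\<tau>. l \<tau> * \<phi> (c * nome \<tau>) / l \<tau>) \<longlongrightarrow> 1) (filtercomap nome (at 0))"
    using l(2) by simp
qed (simp add: F)

text \<open>R/H takes only fifth roots of unity as values and tends to 1, so it equals 1 at some
  point; connectedness of the half plane extends this to all \<tau>.\<close>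

lemma fifth_root_branch_unique:
  assumes R: "fifth_root_branch F l R" and H: "fifth_root_branch F l H"
    and l: "\<And>\<tau>. l \<tau> \<noteq> 0" and nz: "\<And>\<tau>. Im \<tau> > 0 \<Longrightarrow> H \<tau> \<noteq> 0" and \<tau>: "Im \<tau> > 0"
  shows "R \<tau> = H \<tau>"
proof -
  let ?N = "filtercomap nome (at 0)"
  have "((\<lambda>\<tau>. (R \<tau> / l \<tau>) / (H \<tau> / l \<tau>)) \<longlongrightarrow> 1 / 1) ?N"
    using R H unfolding fifth_root_branch_def by (intro tendsto_divide) auto
  then have lim: "((\<lambda>\<tau>. R \<tau> / H \<tau>) \<longlongrightarrow> 1) ?N"
    using l by simp
  have "finite {w :: complex. w ^ 5 = 1}"
    by (intro finite_roots_unity) auto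
  \<comment> \<open>A neighbourhood of 1 that excludes the other four fifth roots of unity.\<close>
  then have "open (- ({w :: complex. w ^ 5 = 1} - {1}))"
    by (intro open_Compl finite_imp_closed) auto
  from topological_tendstoD[OF lim this]
  have "\<forall>\<^sub>F \<tau> in ?N. R \<tau> / H \<tau> \<in> - ({w. w ^ 5 = 1} - {1})"
    by simp
  then have "\<forall>\<^sub>F \<tau> in ?N. Im \<tau> > 0 \<and> R \<tau> / H \<tau> = 1"
    using eventually_nome_Im_pos
  proof eventually_elim
    case (elim \<tau>)
    then show ?case
      using R H nz[of \<tau>] by (simp add: fifth_root_branch_def power_divide)
  qed
  then obtain a where a: "Im a > 0" "R a / H a = 1"
    using eventually_happens'[OF filtercomap_nome_neq_bot] by blast
  show ?thesis
  proof (rule eq_if_power_eq_on_connected[where g = R and h = H and S = "{\<tau>. Im \<tau> > 0}"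
          and a = a and d = 5])
    show "connected {\<tau>. Im \<tau> > 0}"
      by (intro convex_connected convex_halfspace_Im_gt)
  qed (use R H a nz \<tau> in \<open>auto simp: fifth_root_branch_def dest: holomorphic_on_imp_continuous_on\<close>)
qed

text \<open>Existence of both branches is asserted alongside the relation, so that the clause
  quantified over all \<open>R\<close> and \<open>S\<close> is not vacuous.\<close>

theorem corollary3p8:
  fixes \<Omega> :: "complex \<Rightarrow> complex \<Rightarrow> complex \<Rightarrow> complex"
    and k :: nat
  defines "\<alpha> \<equiv> complex_of_real golden_alpha"
    and "\<beta> \<equiv> complex_of_real golden_beta"
  defines "F \<equiv> (\<lambda>\<tau>. (quintic_C (\<tau> + of_nat k / 5) ^ 5 - quintic_D (\<tau> + of_nat k / 5) ^ 5)
                      / (\<beta> ^ 5 - \<alpha> ^ 5))"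
    and "G \<equiv> (\<lambda>\<tau>. (\<beta> ^ 5 * quintic_C (\<tau> + of_nat k / 5) ^ 5
                       - \<alpha> ^ 5 * quintic_D (\<tau> + of_nat k / 5) ^ 5)
                      / (\<beta> ^ 5 - \<alpha> ^ 5))"
  assumes relation: "\<And>\<tau>. Im \<tau> > 0 \<Longrightarrow> \<Omega> (nome \<tau>) (quintic_A \<tau>) (quintic_B \<tau>) = 0"
    and k: "k \<in> {0, 1, 2, 3, 4}"
  shows "(\<exists>R. fifth_root_branch F (\<lambda>\<tau>. qpow (\<tau> + of_nat k / 5) (1/5)) R) \<and>
         (\<exists>S. fifth_root_branch G (\<lambda>\<tau>. 1) S) \<and>
         (\<forall>R S. fifth_root_branch F (\<lambda>\<tau>. qpow (\<tau> + of_nat k / 5) (1/5)) R \<longrightarrow>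
                fifth_root_branch G (\<lambda>\<tau>. 1) S \<longrightarrow>
                (\<forall>\<tau>. Im \<tau> > 0 \<longrightarrow> \<Omega> (xi ^ k * nome \<tau>) (R \<tau>) (S \<tau>) = 0)) \<and>
         (\<forall>\<tau>. Im \<tau> > 0 \<longrightarrow>
                quintic_C (\<tau> + of_nat k / 5) = quintic_B (5 * \<tau>) - \<alpha> * xi ^ k * quintic_A (5 * \<tau>) \<and>
                quintic_D (\<tau> + of_nat k / 5) = quintic_B (5 * \<tau>) - \<beta> * xi ^ k * quintic_A (5 * \<tau>))"
proof -
  \<comment> \<open>A and B are split into a leading factor, \<open>l\<close> and 1 respectively,
    and a function of the rotated nome that is holomorphic on the disc with value 1 at 0, as
    \<open>fifth_root_branchI\<close> expects.\<close>
  define l where "l \<tau> = qpow (\<tau> + of_nat k / 5) (1/5)" for \<tau>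
  define a b where "a q = eta_root q * theta_A q" and "b q = eta_root q * theta_B q" for q
  let ?c = "xi ^ k"
  have A: "quintic_A (\<tau> + of_nat k / 5) = l \<tau> * a (?c * nome \<tau>)" if "Im \<tau> > 0" for \<tau>
    using that by (simp add: quintic_A_eq l_def a_def nome_add_fifth)
  have B: "quintic_B (\<tau> + of_nat k / 5) = 1 * b (?c * nome \<tau>)" if "Im \<tau> > 0" for \<tau>
    using that by (simp add: quintic_B_eq b_def nome_add_fifth)
  have C5: "quintic_C \<tau> ^ 5 = quintic_B \<tau> ^ 5 - \<alpha> ^ 5 * quintic_A \<tau> ^ 5" if "Im \<tau> > 0" for \<tau>
    unfolding quintic_C_eq[OF that] quintic_CD_power_5[OF that quintic_C_root(1,2)] quintic_C_root(3)
    by (simp add: \<alpha>_def)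
  have D5: "quintic_D \<tau> ^ 5 = quintic_B \<tau> ^ 5 - \<beta> ^ 5 * quintic_A \<tau> ^ 5" if "Im \<tau> > 0" for \<tau>
    unfolding quintic_D_eq[OF that] quintic_CD_power_5[OF that quintic_D_root(1,2)] quintic_D_root(3)
    by (simp add: \<beta>_def)
  have nz: "\<beta> ^ 5 - \<alpha> ^ 5 \<noteq> 0"
    unfolding \<alpha>_def \<beta>_def by (rule golden_power_5_neq)
  \<comment> \<open>\<open>C5\<close> and \<open>D5\<close> form a linear system for A^5 and B^5
    with determinant \<beta>^5 - \<alpha>^5 up to sign; \<open>F\<close> and \<open>G\<close> are
    its solution by Cramer's rule.\<close>
  have F: "F \<tau> = (l \<tau> * a (?c * nome \<tau>)) ^ 5" and G: "G \<tau> = (1 * b (?c * nome \<tau>)) ^ 5"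
    if "Im \<tau> > 0" for \<tau>
  proof -
    have "Im (\<tau> + of_nat k / 5) > 0"
      using that by simp
    then show "F \<tau> = (l \<tau> * a (?c * nome \<tau>)) ^ 5" "G \<tau> = (1 * b (?c * nome \<tau>)) ^ 5"
      using nz unfolding F_def G_def A[OF that, symmetric] B[OF that, symmetric]
      by (simp_all only: C5 D5 divide_eq_eq simp_thms if_False) (simp_all add: algebra_simps)
  qed
  have l: "l holomorphic_on {\<tau>. Im \<tau> > 0}" "l \<tau> \<noteq> 0" for \<tau>
    unfolding l_def qpow_def by (auto intro!: holomorphic_intros)
  have a: "a holomorphic_on ball 0 1" "a 0 = 1" and b: "b holomorphic_on ball 0 1" "b 0 = 1"
    unfolding a_def b_def using holomorphic_eta_root holomorphic_theta_A holomorphic_theta_B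
    by (auto intro: holomorphic_on_mult simp: eta_root_0)
  have c: "norm ?c = 1"
    by (simp add: norm_power)
  have branch_F: "fifth_root_branch F l (\<lambda>\<tau>. l \<tau> * a (?c * nome \<tau>))"
    by (intro fifth_root_branchI l a c F)
  have branch_G: "fifth_root_branch G (\<lambda>\<tau>. 1) (\<lambda>\<tau>. 1 * b (?c * nome \<tau>))"
    by (intro fifth_root_branchI b c G) auto
  have "\<Omega> (xi ^ k * nome \<tau>) (R \<tau>) (S \<tau>) = 0"
    if R: "fifth_root_branch F l R" and S: "fifth_root_branch G (\<lambda>\<tau>. 1) S"
      and \<tau>: "Im \<tau> > 0" for R S \<tau>
  proof -
    have "norm (?c * nome t) < 1" if "Im t > 0" for t
      using that c by (simp add: norm_mult norm_nome_less_1_iff)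
    then have "R \<tau> = l \<tau> * a (?c * nome \<tau>)" "S \<tau> = 1 * b (?c * nome \<tau>)"
      using fifth_root_branch_unique[OF R branch_F] fifth_root_branch_unique[OF S branch_G] l \<tau>
      by (auto simp: a_def b_def eta_root_nonzero theta_A_nonzero theta_B_nonzero)
    then show ?thesis
      using relation[of "\<tau> + of_nat k / 5"] \<tau> by (simp add: A B nome_add_fifth)
  qed
  moreover have "quintic_C (\<tau> + of_nat k / 5) = quintic_B (5 * \<tau>) - \<alpha> * xi ^ k * quintic_A (5 * \<tau>)"
    "quintic_D (\<tau> + of_nat k / 5) = quintic_B (5 * \<tau>) - \<beta> * xi ^ k * quintic_A (5 * \<tau>)"
    if \<tau>: "Im \<tau> > 0" for \<tau>
  proof -
    let ?t = "\<tau> + of_nat k / 5"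
    have t: "Im ?t > 0" "5 * ?t = 5 * \<tau> + of_nat k"
      using \<tau> by (simp_all add: distrib_left)
    show "quintic_C ?t = quintic_B (5 * \<tau>) - \<alpha> * xi ^ k * quintic_A (5 * \<tau>)"
      using \<tau> quintic_CD_dissect[OF t(1) quintic_C_root(1,2)]
      unfolding quintic_C_eq[OF t(1)] t(2) quintic_C_root(3)
      by (simp add: quintic_A_add_nat quintic_B_add_nat \<alpha>_def)
    show "quintic_D ?t = quintic_B (5 * \<tau>) - \<beta> * xi ^ k * quintic_A (5 * \<tau>)"
      using \<tau> quintic_CD_dissect[OF t(1) quintic_D_root(1,2)]
      unfolding quintic_D_eq[OF t(1)] t(2) quintic_D_root(3)
      by (simp add: quintic_A_add_nat quintic_B_add_nat \<beta>_def)
  qed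
  ultimately show ?thesis
    using branch_F branch_G unfolding l_def by blast
qed

end
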